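(* Let $G=(V,E)$ be a skew-symmetric graph with symmetry $\sigma$, let $T\subseteq V$ be a symmetric set of terminals ($\sigma(T)=T$), and let $T=S\sqcup\sigma(S)$. If $(G,T)$ is inner Eulerian, i.e. for each $v\in V-T$ the number of arcs entering $v$ equals the number of arcs leaving $v$, then $$\tilde\nu_{G,T}=\frac12\sum_{s\in S}\tilde\lambda_{G,T}(s),$$ where $\tilde\nu_{G,T}$ is the maximum cardinality of a symmetric collection of pairwise arc-disjoint essential $T$-paths in $G$, and, for $s\in S$, $\tilde\lambda_{G,T}(s)$ is the minimum cardinality of a symmetric cut in $G$ separating $\{s,\sigma(s)\}$ and $T-\{s,\sigma(s)\}$.
   Context: A skew-symmetric graph is a finite digraph $G=(V,E)$ (parallel arcs allowed, no loops) with a map $\sigma$ that is a fixed-point-free involution on $V$ and a fixed-point-free involution on $E$, such that for each arc $e$ from $u$ to $v$, $\sigma(e)$ is an arc from $\sigma(v)$ to $\sigma(u)$. The symbol $\sqcup$ denotes disjoint union, so $S$ contains exactly one element of each pair $\{s,\sigma(s)\}\subseteq T$. A path is a simple directed path. The path symmetric to $P=(v_0,e_1,v_1,\ldots,e_k,v_k)$ is $\sigma(P)=(\sigma(v_k),\sigma(e_k),\sigma(v_{k-1}),\ldots,\sigma(e_1),\sigma(v_0))$. A collection of paths is symmetric if it is invariant under $P\mapsto\sigma(P)$. A $T$-path is a path whose ends are distinct elements of $T$ and whose other nodes lie in $V-T$. A $T$-path from $s$ to $t$ is essential if $t\ne\sigma(s)$. For $X\subseteq V$, the cut $\delta(X)$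 is the set of all arcs with one end in $X$ and the other in $V-X$ (in either direction). A symmetric cut separating $\{s,\sigma(s)\}$ and $T-\{s,\sigma(s)\}$ is a cut $\delta(X)$ with $\sigma(X)=X$ and $X\cap T=\{s,\sigma(s)\}$. *)

theory Defs
  imports Complex_Main "Graph_Theory.Arc_Walk"
begin

text \<open>
  The symmetry is given by its action \<open>\<sigma>V\<close> on the nodes and its action \<open>\<sigma>E\<close> on the arcs;
  the values of these maps outside of the node set and the arc set are irrelevant.
\<close>

locale skew_symmetric_graph = fin_digraph G + loopfree_digraph G
  for G :: "('a, 'b) pre_digraph" +
  fixes \<sigma>V :: "'a \<Rightarrow> 'a" and \<sigma>E :: "'b \<Rightarrow> 'b"
  assumes node_closed: "v \<in> verts G \<Longrightarrow> \<sigma>V v \<in> verts G"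
    and node_involution: "v \<in> verts G \<Longrightarrow> \<sigma>V (\<sigma>V v) = v"
    and node_no_fixpoint: "v \<in> verts G \<Longrightarrow> \<sigma>V v \<noteq> v"
    and arc_closed: "e \<in> arcs G \<Longrightarrow> \<sigma>E e \<in> arcs G"
    and arc_involution: "e \<in> arcs G \<Longrightarrow> \<sigma>E (\<sigma>E e) = e"
    and arc_no_fixpoint: "e \<in> arcs G \<Longrightarrow> \<sigma>E e \<noteq> e"
    and tail_symmetric: "e \<in> arcs G \<Longrightarrow> tail G (\<sigma>E e) = \<sigma>V (head G e)"
    and head_symmetric: "e \<in> arcs G \<Longrightarrow> head G (\<sigma>E e) = \<sigma>V (tail G e)"

definition inner_Eulerian :: "('a, 'b) pre_digraph \<Rightarrow> 'a set \<Rightarrow> bool" where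
  "inner_Eulerian G T \<longleftrightarrow> (\<forall>v \<in> verts G - T. in_degree G v = out_degree G v)"

definition T_path :: "('a, 'b) pre_digraph \<Rightarrow> 'a set \<Rightarrow> 'a \<Rightarrow> 'b list \<Rightarrow> 'a \<Rightarrow> bool" where
  "T_path G T s p t \<longleftrightarrow>
     s \<in> T \<and> t \<in> T \<and> s \<noteq> t \<and> pre_digraph.apath G s p t \<and>
     set (pre_digraph.awalk_verts G s p) - {s, t} \<subseteq> verts G - T"

text \<open>
  A \<open>T\<close>-path has distinct ends, hence at least one arc, so its sequence of nodes is determined
  by its list of arcs. Collections of \<open>T\<close>-paths are therefore sets of arc lists.
\<close>

definition essential_T_path ::
    "('a, 'b) pre_digraph \<Rightarrow> ('a \<Rightarrow> 'a) \<Rightarrow> 'a set \<Rightarrow> 'b list \<Rightarrow> bool" where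
  "essential_T_path G \<sigma>V T p \<longleftrightarrow> (\<exists>s t. T_path G T s p t \<and> t \<noteq> \<sigma>V s)"

definition symmetric_path :: "('b \<Rightarrow> 'b) \<Rightarrow> 'b list \<Rightarrow> 'b list" where
  "symmetric_path \<sigma>E p = rev (map \<sigma>E p)"

definition symmetric_collection :: "('b \<Rightarrow> 'b) \<Rightarrow> 'b list set \<Rightarrow> bool" where
  "symmetric_collection \<sigma>E P \<longleftrightarrow> symmetric_path \<sigma>E ` P = P"

definition arc_disjoint :: "'b list set \<Rightarrow> bool" where
  "arc_disjoint P \<longleftrightarrow> (\<forall>p \<in> P. \<forall>q \<in> P. p \<noteq> q \<longrightarrow> set p \<inter> set q = {})"

definition essential_packings ::
    "('a, 'b) pre_digraph \<Rightarrow> ('a \<Rightarrow> 'a) \<Rightarrow> ('b \<Rightarrow> 'b) \<Rightarrow> 'a set \<Rightarrow> 'b list set set" where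
  "essential_packings G \<sigma>V \<sigma>E T =
     {P. (\<forall>p \<in> P. essential_T_path G \<sigma>V T p) \<and> symmetric_collection \<sigma>E P \<and> arc_disjoint P}"

definition max_essential_packing ::
    "('a, 'b) pre_digraph \<Rightarrow> ('a \<Rightarrow> 'a) \<Rightarrow> ('b \<Rightarrow> 'b) \<Rightarrow> 'a set \<Rightarrow> nat" where
  "max_essential_packing G \<sigma>V \<sigma>E T = Max (card ` essential_packings G \<sigma>V \<sigma>E T)"

definition cut :: "('a, 'b) pre_digraph \<Rightarrow> 'a set \<Rightarrow> 'b set" where
  "cut G X = {e \<in> arcs G. tail G e \<in> X \<and> head G e \<in> verts G - X
                        \<or> tail G e \<in> verts G - X \<and> head G e \<in> X}"

definition separating_symmetric_cuts ::
    "('a, 'b) pre_digraph \<Rightarrow> ('a \<Rightarrow> 'a) \<Rightarrow> 'a set \<Rightarrow> 'a \<Rightarrow> 'b set set" where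
  "separating_symmetric_cuts G \<sigma>V T s =
     {cut G X | X. X \<subseteq> verts G \<and> \<sigma>V ` X = X \<and> X \<inter> T = {s, \<sigma>V s}}"

definition min_symmetric_cut ::
    "('a, 'b) pre_digraph \<Rightarrow> ('a \<Rightarrow> 'a) \<Rightarrow> 'a set \<Rightarrow> 'a \<Rightarrow> nat" where
  "min_symmetric_cut G \<sigma>V T s = Min (card ` separating_symmetric_cuts G \<sigma>V T s)"

text \<open>The maximum and the minimum range over nonempty finite sets.\<close>

lemma (in skew_symmetric_graph) essential_packings_finite_nonempty:
  shows "finite (essential_packings G \<sigma>V \<sigma>E T)" and "essential_packings G \<sigma>V \<sigma>E T \<noteq> {}"
proof -
  have "{p. essential_T_path G \<sigma>V T p} \<subseteq> (\<lambda>(u, p, v). p) ` {(u, p, v). apath u p v}"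
  proof
    fix p assume "p \<in> {p. essential_T_path G \<sigma>V T p}"
    then obtain u v where "apath u p v"
      unfolding essential_T_path_def T_path_def by blast
    then show "p \<in> (\<lambda>(u, p, v). p) ` {(u, p, v). apath u p v}"
      by (intro image_eqI[of _ _ "(u, p, v)"]) simp_all
  qed
  then have "finite {p. essential_T_path G \<sigma>V T p}"
    by (rule finite_subset) (rule finite_imageI[OF apaths_finite_triple])
  then have "finite (Pow {p. essential_T_path G \<sigma>V T p})" by simp
  then show "finite (essential_packings G \<sigma>V \<sigma>E T)"
    by (rule rev_finite_subset) (auto simp: essential_packings_def)
  have "{} \<in> essential_packings G \<sigma>V \<sigma>E T"
    by (simp add: essential_packings_def symmetric_collection_def arc_disjoint_def)
  then show "essential_packings G \<sigma>V \<sigma>E T \<noteq> {}" by blast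
qed

lemma (in skew_symmetric_graph) separating_symmetric_cuts_finite_nonempty:
  assumes "T \<subseteq> verts G" and "\<sigma>V ` T = T" and "s \<in> T"
  shows "finite (separating_symmetric_cuts G \<sigma>V T s)" and "separating_symmetric_cuts G \<sigma>V T s \<noteq> {}"
proof -
  have "finite (Pow (arcs G))" by simp
  then show "finite (separating_symmetric_cuts G \<sigma>V T s)"
    by (rule rev_finite_subset) (auto simp: separating_symmetric_cuts_def cut_def)
  have "s \<in> verts G" "\<sigma>V s \<in> T" using assms by auto
  then have "cut G {s, \<sigma>V s} \<in> separating_symmetric_cuts G \<sigma>V T s"
    unfolding separating_symmetric_cuts_def
    using assms node_involution[of s] by (intro CollectI exI[of _ "{s, \<sigma>V s}"]) auto
  then show "separating_symmetric_cuts G \<sigma>V T s \<noteq> {}" by blast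
qed

text \<open>
  On arc lists, \<^const>\<open>symmetric_path\<close> is the symmetric path: the image of a path from \<open>u\<close> to \<open>v\<close>
  runs from \<open>\<sigma>V v\<close> to \<open>\<sigma>V u\<close> through the images of its nodes in reverse order.
\<close>

lemma (in skew_symmetric_graph) awalk_symmetric_path:
  assumes "awalk u p v"
  shows "awalk (\<sigma>V v) (symmetric_path \<sigma>E p) (\<sigma>V u) \<and>
    awalk_verts (\<sigma>V v) (symmetric_path \<sigma>E p) = rev (map \<sigma>V (awalk_verts u p))"
  using assms
proof (induction p arbitrary: u)
  case Nil
  then show ?case by (auto simp: symmetric_path_def awalk_Nil_iff node_closed)
next
  case (Cons e p)
  then have e: "e \<in> arcs G" "u = tail G e" and p: "awalk (head G e) p v"
    by (auto simp: awalk_Cons_iff)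
  let ?q = "symmetric_path \<sigma>E p"
  have split: "symmetric_path \<sigma>E (e # p) = ?q @ [\<sigma>E e]"
    by (simp add: symmetric_path_def)
  have q: "awalk (\<sigma>V v) ?q (\<sigma>V (head G e))"
    and qv: "awalk_verts (\<sigma>V v) ?q = rev (map \<sigma>V (awalk_verts (head G e) p))"
    using Cons.IH[OF p] by auto
  have last: "awlast (\<sigma>V v) ?q = \<sigma>V (head G e)" using q unfolding awalk_def by (blast intro: awlast_if_cas)
  have a: "awalk (\<sigma>V (head G e)) [\<sigma>E e] (\<sigma>V u)"
    using e by (simp add: awalk_simps arc_closed tail_symmetric head_symmetric node_closed)
  have w: "awalk (\<sigma>V v) (?q @ [\<sigma>E e]) (\<sigma>V u)"
    unfolding awalk_append_iff last using q a by (rule conjI)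
  have "awalk_verts (\<sigma>V v) (?q @ [\<sigma>E e]) = rev (map \<sigma>V (awalk_verts u (e # p)))"
    unfolding awalk_verts_append[OF w] qv using e by (simp add: head_symmetric)
  with w show ?case unfolding split by (rule conjI)
qed

end

theory Submission
  imports Defs
begin

text \<open>
  An essential path from \<open>s\<close> to \<open>t\<close> meets every symmetric cut separating the pair of \<open>s\<close> and
  every one separating the pair of \<open>t\<close>, which gives \<open>\<le>\<close>.

  For \<open>\<ge>\<close>, split off arcs at inner nodes: for an arc \<open>e\<close> entering an inner node \<open>v\<close>, replace a pair
  \<open>e\<close>, \<open>f\<close> with \<open>f\<close> leaving \<open>v\<close> by one arc, and do the same with the symmetric pair at
  \<open>\<sigma>V v\<close>. The sizes of all symmetric cuts separating a given pair are congruent modulo 4, and a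
  double splitting lowers them by 0 or 4, so only tight cuts matter. Uncrossing the tight cuts
  shows that for each \<open>e\<close> some \<open>f\<close> keeps all the minima. Once every arc joins two terminals, the
  essential arcs form an optimal packing, and each arc stands for a walk of the original graph.
\<close>

section \<open>Cuts in skew-symmetric graphs\<close>

text \<open>The involution splits \<open>A\<close> into pairs \<open>{x, s x}\<close>, and each pair
  contributes \<open>2 * f x\<close>. The induction removes one pair at a time.\<close>

lemma even_sum_involution:
  fixes f :: "'c \<Rightarrow> int"
  assumes "finite A" and "\<And>x. x \<in> A \<Longrightarrow> s x \<in> A \<and> s (s x) = x \<and> s x \<noteq> x \<and> f (s x) = f x"
  shows "even (sum f A)"
  using assms
proof (induction "card A" arbitrary: A rule: less_induct)
  case less
  show ?case
  proof (cases "A = {}")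
    case False
    then obtain x where x: "x \<in> A" by blast
    let ?B = "A - {x, s x}"
    have sub: "{x, s x} \<subseteq> A" using x less.prems(2)[OF x] by simp
    have ne: "s x \<noteq> x" "f (s x) = f x" using less.prems(2)[OF x] by auto
    have "card ?B < card A"
      using x less.prems(1) by (intro psubset_card_mono) auto
    moreover have "s y \<in> ?B \<and> s (s y) = y \<and> s y \<noteq> y \<and> f (s y) = f y" if "y \<in> ?B" for y
      using that less.prems(2)[of y] less.prems(2)[OF x] by auto
    ultimately have "even (sum f ?B)"
      using less.hyps[of ?B] less.prems(1) by simp
    moreover have "sum f A = sum f ?B + (f x + f (s x))"
      using sum.subset_diff[OF sub less.prems(1), of f] ne by simp
    ultimately show ?thesis using ne(2) by simp
  qed simp
qed

text \<open>An integer indicator, so that cut sizes can be subtracted and compared arc by arc, and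
  so that products of crossings make sense.\<close>

definition crossing :: "('a, 'b) pre_digraph \<Rightarrow> 'a set \<Rightarrow> 'b \<Rightarrow> int" where
  "crossing G X e = of_bool ((tail G e \<in> X) \<noteq> (head G e \<in> X))"

definition cut_size :: "('a, 'b) pre_digraph \<Rightarrow> 'a set \<Rightarrow> int" where
  "cut_size G X = (\<Sum>e \<in> arcs G. crossing G X e)"

text \<open>The terminal pair is not a parameter: it can be read off as \<open>X \<inter> T\<close>,
  and lower bounds on cuts are later given as functions of that set.\<close>

definition separating :: "('a, 'b) pre_digraph \<Rightarrow> ('a \<Rightarrow> 'a) \<Rightarrow> 'a set \<Rightarrow> 'a set \<Rightarrow> bool" where
  "separating G \<sigma>V T X \<longleftrightarrow>
     X \<subseteq> verts G \<and> \<sigma>V ` X = X \<and> (\<exists>s \<in> T. X \<inter> T = {s, \<sigma>V s})"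

lemma (in fin_digraph) card_cut:
  assumes "X \<subseteq> verts G"
  shows "int (card (cut G X)) = cut_size G X"
proof -
  have "cut G X = {e \<in> arcs G. (tail G e \<in> X) \<noteq> (head G e \<in> X)}"
    using assms unfolding cut_def by auto
  then show ?thesis
    by (simp add: cut_size_def crossing_def of_bool_def sum.If_cases Int_def)
qed

lemma (in fin_digraph) cut_size_complement:
  "cut_size G (verts G - X) = cut_size G X"
  unfolding cut_size_def crossing_def by (intro sum.cong) auto

text \<open>Submodularity of undirected cuts, which holds for each arc separately.\<close>

lemma cut_size_Int_Un:
  "cut_size G (X \<inter> Y) + cut_size G (X \<union> Y) \<le> cut_size G X + cut_size G Y"
  unfolding cut_size_def sum.distrib[symmetric]
  by (intro sum_mono) (auto simp: crossing_def)

text \<open>The arc \<open>e\<close> crosses both \<open>X\<close> and \<open>Y\<close>, but neither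
  their intersection nor their union.\<close>

lemma (in fin_digraph) cut_size_Int_Un_strict:
  assumes "e \<in> arcs G" "tail G e \<in> X - Y \<and> head G e \<in> Y - X"
  shows "cut_size G (X \<inter> Y) + cut_size G (X \<union> Y) < cut_size G X + cut_size G Y"
  unfolding cut_size_def sum.distrib[symmetric]
  using assms by (intro sum_strict_mono_ex1) (auto simp: crossing_def intro!: bexI[of _ e])

text \<open>Posimodularity, the form that submodularity takes when one of the two sets is
  complemented.\<close>

lemma cut_size_Diff:
  "cut_size G (X - Y) + cut_size G (Y - X) \<le> cut_size G X + cut_size G Y"
  unfolding cut_size_def sum.distrib[symmetric]
  by (intro sum_mono) (auto simp: crossing_def)

text \<open>An arc between \<open>X \<inter> Y\<close> and the outside of
  \<open>X \<union> Y\<close> crosses both sets, but neither difference.\<close>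

lemma (in fin_digraph) cut_size_Diff_strict:
  assumes "e \<in> arcs G" "(tail G e \<in> X \<inter> Y) \<and> head G e \<notin> X \<union> Y \<or> (head G e \<in> X \<inter> Y) \<and> tail G e \<notin> X \<union> Y"
  shows "cut_size G (X - Y) + cut_size G (Y - X) < cut_size G X + cut_size G Y"
  unfolding cut_size_def sum.distrib[symmetric]
  using assms by (intro sum_strict_mono_ex1) (auto simp: crossing_def intro!: bexI[of _ e])

lemma (in fin_digraph) sum_of_bool_head: "(\<Sum>e \<in> arcs G. of_bool (head G e = v)) = int (in_degree G v)"
  by (simp add: in_degree_def in_arcs_def of_bool_def sum.If_cases Int_def)

lemma (in fin_digraph) sum_of_bool_tail: "(\<Sum>e \<in> arcs G. of_bool (tail G e = v)) = int (out_degree G v)"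
  by (simp add: out_degree_def out_arcs_def of_bool_def sum.If_cases Int_def)

context skew_symmetric_graph
begin

lemma inj_on_nodes: "inj_on \<sigma>V (verts G)"
  using node_involution by (metis inj_onI)

lemma symmetric_mem_iff:
  assumes "X \<subseteq> verts G" "\<sigma>V ` X = X" "v \<in> verts G"
  shows "\<sigma>V v \<in> X \<longleftrightarrow> v \<in> X"
  using assms node_involution by (metis image_eqI)

lemma symmetric_Int:
  assumes "X \<subseteq> verts G" "\<sigma>V ` X = X" "Y \<subseteq> verts G" "\<sigma>V ` Y = Y"
  shows "\<sigma>V ` (X \<inter> Y) = X \<inter> Y"
  using inj_on_image_Int[of \<sigma>V "verts G" X Y] assms inj_on_nodes by simp

lemma symmetric_Diff:
  assumes "X \<subseteq> verts G" "\<sigma>V ` X = X" "Y \<subseteq> verts G" "\<sigma>V ` Y = Y"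
  shows "\<sigma>V ` (X - Y) = X - Y"
  using inj_on_image_set_diff[of \<sigma>V "verts G" X Y] assms inj_on_nodes by auto

lemma node_image: "\<sigma>V ` verts G = verts G"
  using node_closed node_involution by (metis image_eqI image_subsetI subsetI subset_antisym)

lemma card_arcs_symmetric:
  assumes "\<And>e. e \<in> arcs G \<Longrightarrow> Q (\<sigma>E e) \<longleftrightarrow> P e"
  shows "card {e \<in> arcs G. P e} = card {e \<in> arcs G. Q e}"
proof -
  have "P (\<sigma>E e) \<longleftrightarrow> Q e" if "e \<in> arcs G" for e
    using assms[of "\<sigma>E e"] that by (simp add: arc_closed arc_involution)
  then have "bij_betw \<sigma>E {e \<in> arcs G. P e} {e \<in> arcs G. Q e}"
    using assms arc_closed arc_involution by (intro bij_betw_byWitness[where f' = \<sigma>E]) auto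
  then show ?thesis by (rule bij_betw_same_card)
qed

lemma in_degree_symmetric:
  assumes "v \<in> verts G"
  shows "in_degree G (\<sigma>V v) = out_degree G v"
  unfolding in_degree_def out_degree_def in_arcs_def out_arcs_def
  by (rule card_arcs_symmetric) (use assms tail_symmetric node_involution in \<open>metis head_in_verts\<close>)

lemma out_degree_symmetric:
  assumes "v \<in> verts G"
  shows "out_degree G (\<sigma>V v) = in_degree G v"
  using in_degree_symmetric[of "\<sigma>V v"] assms by (simp add: node_closed node_involution)

end

text \<open>A locale, because the cut arguments are applied not only to \<open>G\<close> but also to
  the auxiliary graphs whose arcs are walks of \<open>G\<close>.\<close>

locale inner_Eulerian_skew_graph = skew_symmetric_graph +
  fixes T :: "'a set"
  assumes T_subset: "T \<subseteq> verts G" and T_symmetric: "\<sigma>V ` T = T"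
    and Eulerian: "inner_Eulerian G T"
begin

lemma degrees_inner:
  assumes "v \<in> verts G - T"
  shows "in_degree G v = out_degree G v"
  using Eulerian assms by (simp add: inner_Eulerian_def)

lemma inner_closed: "v \<in> verts G - T \<Longrightarrow> \<sigma>V v \<in> verts G - T"
  using symmetric_mem_iff[OF T_subset T_symmetric] node_closed by blast

section \<open>Separating sets under intersection, union and difference\<close>

abbreviation sep where "sep \<equiv> separating G \<sigma>V T"

text \<open>Each separating set meets \<open>T\<close> in one orbit of \<open>\<sigma>V\<close>, and
  two orbits coincide or are disjoint. This decides whether two sets are uncrossed by intersection
  and union or by differences.\<close>

lemma sep_terminals:
  assumes "sep X" "sep Y"
  shows "X \<inter> T = Y \<inter> T \<or> X \<inter> Y \<inter> T = {}"
proof -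
  from assms obtain s t where s: "s \<in> T" "X \<inter> T = {s, \<sigma>V s}" and t: "t \<in> T" "Y \<inter> T = {t, \<sigma>V t}"
    by (auto simp: separating_def)
  have inv: "\<sigma>V (\<sigma>V s) = s" "\<sigma>V (\<sigma>V t) = t" using s t T_subset node_involution by auto
  show ?thesis
  proof (cases "s = t \<or> s = \<sigma>V t")
    case True
    then have "{s, \<sigma>V s} = {t, \<sigma>V t}" using inv(2) by (elim disjE) (simp_all add: insert_commute)
    then show ?thesis using s t by simp
  next
    case False
    moreover have "\<sigma>V s \<noteq> t" "\<sigma>V s \<noteq> \<sigma>V t" using False inv by metis+
    ultimately have "{s, \<sigma>V s} \<inter> {t, \<sigma>V t} = {}" by simp
    moreover have "X \<inter> Y \<inter> T = (X \<inter> T) \<inter> (Y \<inter> T)" by blast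
    ultimately show ?thesis using s t by simp
  qed
qed

lemma sep_Int: "sep X \<Longrightarrow> sep Y \<Longrightarrow> X \<inter> T = Y \<inter> T \<Longrightarrow> sep (X \<inter> Y)"
proof -
  assume a: "sep X" "sep Y" "X \<inter> T = Y \<inter> T"
  then have "X \<inter> Y \<inter> T = X \<inter> T" by auto
  then show "sep (X \<inter> Y)" using a unfolding separating_def by (auto simp: symmetric_Int)
qed

lemma sep_Un: "sep X \<Longrightarrow> sep Y \<Longrightarrow> X \<inter> T = Y \<inter> T \<Longrightarrow> sep (X \<union> Y)"
  unfolding separating_def by (auto simp: image_Un Int_Un_distrib2)

lemma sep_Diff: "sep X \<Longrightarrow> sep Y \<Longrightarrow> X \<inter> Y \<inter> T = {} \<Longrightarrow> sep (X - Y)"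
proof -
  assume a: "sep X" "sep Y" "X \<inter> Y \<inter> T = {}"
  then have "(X - Y) \<inter> T = X \<inter> T" by auto
  then show "sep (X - Y)" using a unfolding separating_def by (auto simp: symmetric_Diff)
qed

section \<open>Existence of a splittable pair of arcs\<close>

text \<open>Adding \<open>v\<close> removes all arcs leaving \<open>v\<close> from the cut, and the
  newly crossing arcs are among those entering \<open>v\<close>. Both kinds are equally many, but
  \<open>e\<close> enters \<open>v\<close> and leaves the cut as well. By symmetry, the arcs at
  \<open>\<sigma>V v\<close> behave the same way with directions reversed.\<close>

lemma cut_size_insert_less:
  assumes X: "X \<subseteq> verts G" "\<sigma>V ` X = X" and v: "v \<in> verts G - T" "v \<notin> X"
    and e: "e \<in> arcs G" "tail G e \<in> X" "head G e = v"
    and out: "\<And>f. f \<in> arcs G \<Longrightarrow> tail G f = v \<Longrightarrow> head G f \<in> X"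
  shows "cut_size G (X \<union> {v, \<sigma>V v}) < cut_size G X"
proof -
  \<comment> \<open>Out-degree minus in-degree at \<open>v\<close>, plus the opposite difference at
    \<open>\<sigma>V v\<close>, distributed over the arcs. The total is 0, while \<open>?g p\<close>
    bounds from below the amount by which arc \<open>p\<close> lowers the cut.\<close>
  let ?g = "\<lambda>p. of_bool (tail G p = v) - of_bool (head G p = v)
    + (of_bool (head G p = \<sigma>V v) - of_bool (tail G p = \<sigma>V v)) :: int"
  have vv: "v \<in> verts G" "\<sigma>V v \<in> verts G" "\<sigma>V v \<notin> X" "\<sigma>V v \<noteq> v" "\<sigma>V (\<sigma>V v) = v"
    using v X symmetric_mem_iff node_closed node_no_fixpoint node_involution by auto
  have into: "tail G p \<in> X" if "p \<in> arcs G" "head G p = \<sigma>V v" for p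
  proof -
    have "head G (\<sigma>E p) \<in> X"
      using that vv by (intro out) (simp_all add: arc_closed tail_symmetric)
    then show ?thesis using that X by (simp add: head_symmetric symmetric_mem_iff)
  qed
  have "sum ?g (arcs G) = 0"
    using degrees_inner[OF v(1)] in_degree_symmetric[OF vv(1)] out_degree_symmetric[OF vv(1)]
    by (simp only: sum.distrib sum_subtractf sum_of_bool_head sum_of_bool_tail)
  moreover have "sum ?g (arcs G) < (\<Sum>p \<in> arcs G. crossing G X p - crossing G (X \<union> {v, \<sigma>V v}) p)"
  proof (rule sum_strict_mono_ex1)
    show "\<forall>p \<in> arcs G. ?g p \<le> crossing G X p - crossing G (X \<union> {v, \<sigma>V v}) p"
    proof
      fix p assume p: "p \<in> arcs G"
      show "?g p \<le> crossing G X p - crossing G (X \<union> {v, \<sigma>V v}) p"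
        using out[OF p] into[OF p] v(2) vv(3,4) no_loops[OF p] by (auto simp: crossing_def)
    qed
    \<comment> \<open>The arc \<open>e\<close> stops crossing although its weight is -1, which makes
      the inequality strict.\<close>
    have "\<sigma>V v \<noteq> tail G e" using e vv by auto
    then show "\<exists>p \<in> arcs G. ?g p < crossing G X p - crossing G (X \<union> {v, \<sigma>V v}) p"
      using e v(2) vv(3,4) by (intro bexI[of _ e]) (auto simp: crossing_def)
  qed simp
  ultimately show ?thesis
    by (simp add: cut_size_def sum_subtractf)
qed

text \<open>
  A tight set blocks the pair \<open>(e, f)\<close> if it contains the outer ends of both arcs but not \<open>v\<close>, or
  \<open>v\<close> but neither outer end. Uncrossing reduces all blocking sets to a single one that blocks
  every \<open>f\<close>; moving \<open>v\<close> and \<open>\<sigma>V v\<close> across its boundary then gives too small a cut.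
\<close>

lemma ex_unblocked_arc:
  fixes l :: "'a set \<Rightarrow> int"
  assumes bound: "\<And>X. sep X \<Longrightarrow> l (X \<inter> T) \<le> cut_size G X"
    and e: "e \<in> arcs G" "head G e = v" "v \<notin> T"
  shows "\<exists>f \<in> arcs G. tail G f = v \<and>
    (\<forall>X. sep X \<longrightarrow> cut_size G X = l (X \<inter> T) \<longrightarrow> crossing G X e = 0 \<or> crossing G X f = 0)"
proof (rule ccontr)
  assume no: "\<not> ?thesis"
  define tight where "tight X \<longleftrightarrow> sep X \<and> cut_size G X = l (X \<inter> T)" for X
  define u where "u = tail G e"
  have v: "v \<in> verts G - T" and u: "u \<in> verts G" using e by (auto simp: u_def)
  have blocked: "\<exists>X. tight X \<and> (u \<in> X \<and> v \<notin> X \<and> head G f \<in> X \<or> v \<in> X \<and> u \<notin> X \<and> head G f \<notin> X)"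
    if f: "f \<in> arcs G" "tail G f = v" for f
  proof -
    obtain X where "tight X" "crossing G X e \<noteq> 0" "crossing G X f \<noteq> 0"
      using no f unfolding tight_def by blast
    then show ?thesis using f e by (auto simp: crossing_def u_def)
  qed
  have tight_sep: "tight X \<Longrightarrow> sep X" for X by (simp add: tight_def)
  \<comment> \<open>Both new sets are bounded below by the same value of \<open>l\<close>, so
    submodularity leaves no slack in either bound.\<close>
  have tight_Int_Un: "tight (X \<inter> Y)" "tight (X \<union> Y)"
    if "tight X" "tight Y" "X \<inter> T = Y \<inter> T" for X Y
  proof -
    have s: "sep (X \<inter> Y)" "sep (X \<union> Y)" using that by (auto simp: tight_def sep_Int sep_Un)
    have "X \<inter> Y \<inter> T = X \<inter> T" "(X \<union> Y) \<inter> T = X \<inter> T" using that by auto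
    then show "tight (X \<inter> Y)" "tight (X \<union> Y)"
      using s bound[OF s(1)] bound[OF s(2)] cut_size_Int_Un[of G X Y] that
      unfolding tight_def by auto
  qed
  have tight_Diff: "tight (X - Y)" if "tight X" "tight Y" "X \<inter> Y \<inter> T = {}" for X Y
  proof -
    have s: "sep (X - Y)" "sep (Y - X)" using that by (auto simp: tight_def intro!: sep_Diff)
    have "(X - Y) \<inter> T = X \<inter> T" "(Y - X) \<inter> T = Y \<inter> T" using that by auto
    then show "tight (X - Y)"
      using s bound[OF s(1)] bound[OF s(2)] cut_size_Diff[of G X Y] that
      unfolding tight_def by auto
  qed
  \<comment> \<open>If two blocking sets of the same kind had different terminal pairs,
    \<open>e\<close> would join their intersection to the outside of their union. Posimodularity
    would then be strict, although all four cuts are tight.\<close>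
  have same: "X \<inter> T = Y \<inter> T" if "tight X" "tight Y"
    "u \<in> X \<inter> Y \<and> v \<notin> X \<union> Y \<or> v \<in> X \<inter> Y \<and> u \<notin> X \<union> Y" for X Y
  proof (rule ccontr)
    assume "X \<inter> T \<noteq> Y \<inter> T"
    then have d: "X \<inter> Y \<inter> T = {}" using sep_terminals that tight_sep by blast
    then have "Y \<inter> X \<inter> T = {}" by auto
    then have t: "tight (X - Y)" "tight (Y - X)" using tight_Diff that d by auto
    have "(X - Y) \<inter> T = X \<inter> T" "(Y - X) \<inter> T = Y \<inter> T" using d by auto
    then show False
      using cut_size_Diff_strict[of e X Y] t that e unfolding tight_def u_def by auto
  qed
  \<comment> \<open>Blocking sets of different kinds have different pairs: otherwise
    \<open>e\<close> runs from \<open>X - Y\<close> to \<open>Y - X\<close>, and submodularity would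
    be strict among tight sets.\<close>
  have opposite: "X \<inter> Y \<inter> T = {}" if "tight X" "tight Y" "u \<in> X - Y" "v \<in> Y - X" for X Y
  proof (rule ccontr)
    assume "X \<inter> Y \<inter> T \<noteq> {}"
    then have d: "X \<inter> T = Y \<inter> T" using sep_terminals that tight_sep by blast
    then have t: "tight (X \<inter> Y)" "tight (X \<union> Y)" using tight_Int_Un that by auto
    have "(X \<inter> Y) \<inter> T = X \<inter> T" "(X \<union> Y) \<inter> T = Y \<inter> T" using d by auto
    then show False
      using cut_size_Int_Un_strict[of e X Y] t that e d unfolding tight_def u_def by auto
  qed
  have fin: "finite {X. tight X \<and> P X}" for P
    by (rule finite_subset[of _ "Pow (verts G)"]) (auto simp: tight_def separating_def)
  have no_A: False if "tight X" "u \<in> X" "v \<notin> X"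
    "\<And>f. f \<in> arcs G \<Longrightarrow> tail G f = v \<Longrightarrow> head G f \<in> X" for X
  proof -
    have X: "X \<subseteq> verts G" "\<sigma>V ` X = X" "sep X" using that by (auto simp: tight_def separating_def)
    have "cut_size G (X \<union> {v, \<sigma>V v}) < cut_size G X"
      using X that v e by (intro cut_size_insert_less) (auto simp: u_def)
    moreover have T: "(X \<union> {v, \<sigma>V v}) \<inter> T = X \<inter> T" using v inner_closed[OF v] by auto
    moreover have "sep (X \<union> {v, \<sigma>V v})"
      using X(3) v node_closed node_involution unfolding separating_def T by auto
    ultimately show False using bound[of "X \<union> {v, \<sigma>V v}"] that(1) by (auto simp: tight_def)
  qed
  have no_B: False if "tight Y" "v \<in> Y" "u \<notin> Y"
    "\<And>f. f \<in> arcs G \<Longrightarrow> tail G f = v \<Longrightarrow> head G f \<notin> Y" for Y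
  proof -
    have Y: "Y \<subseteq> verts G" "\<sigma>V ` Y = Y" "sep Y" using that by (auto simp: tight_def separating_def)
    \<comment> \<open>Removing \<open>v\<close> and its mirror from \<open>Y\<close> is adding them
      to the complement, which has the same cut.\<close>
    have "\<sigma>V ` (verts G - Y) = verts G - Y"
      using Y node_image by (intro symmetric_Diff) auto
    then have "cut_size G (verts G - Y \<union> {v, \<sigma>V v}) < cut_size G (verts G - Y)"
      using that(2-4) v u e by (intro cut_size_insert_less[of _ _ e]) (simp_all add: u_def)
    moreover have "verts G - Y \<union> {v, \<sigma>V v} = verts G - (Y - {v, \<sigma>V v})"
      using v node_closed by auto
    ultimately have less: "cut_size G (Y - {v, \<sigma>V v}) < cut_size G Y"
      by (simp add: cut_size_complement)
    moreover have T: "(Y - {v, \<sigma>V v}) \<inter> T = Y \<inter> T" using v inner_closed[OF v] by auto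
    moreover have "\<sigma>V ` (Y - {v, \<sigma>V v}) = Y - {v, \<sigma>V v}"
      using Y v node_closed node_involution by (intro symmetric_Diff) auto
    then have "sep (Y - {v, \<sigma>V v})"
      using Y(3) unfolding separating_def T by auto
    ultimately show False using bound[of "Y - {v, \<sigma>V v}"] that(1) by (auto simp: tight_def)
  qed
  \<comment> \<open>Sets of the first kind are closed under union, because \<open>same\<close> gives
    them a common terminal pair; hence there is a largest one. Dually, \<open>ex_B\<close> finds a
    smallest set of the second kind.\<close>
  have ex_A: "\<exists>X. tight X \<and> u \<in> X \<and> v \<notin> X \<and> (\<forall>Y. tight Y \<and> u \<in> Y \<and> v \<notin> Y \<longrightarrow> Y \<subseteq> X)"
    if ex: "tight X0" "u \<in> X0" "v \<notin> X0" for X0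
  proof -
    let ?F = "{X. tight X \<and> u \<in> X \<and> v \<notin> X}"
    obtain X where X: "X \<in> ?F" "\<forall>Y \<in> ?F. X \<subseteq> Y \<longrightarrow> X = Y"
      using finite_has_maximal[OF fin, of "\<lambda>X. u \<in> X \<and> v \<notin> X"] ex by blast
    have "Y \<subseteq> X" if "Y \<in> ?F" for Y
    proof -
      have "tight (X \<union> Y)" using X(1) that same by (intro tight_Int_Un) auto
      then show ?thesis using X that by blast
    qed
    then show ?thesis using X(1) by blast
  qed
  have ex_B: "\<exists>X. tight X \<and> v \<in> X \<and> u \<notin> X \<and> (\<forall>Y. tight Y \<and> v \<in> Y \<and> u \<notin> Y \<longrightarrow> X \<subseteq> Y)"
    if ex: "tight X0" "v \<in> X0" "u \<notin> X0" for X0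
  proof -
    let ?F = "{X. tight X \<and> v \<in> X \<and> u \<notin> X}"
    obtain X where X: "X \<in> ?F" "\<forall>Y \<in> ?F. Y \<subseteq> X \<longrightarrow> X = Y"
      using finite_has_minimal[OF fin, of "\<lambda>X. v \<in> X \<and> u \<notin> X"] ex by blast
    have "X \<subseteq> Y" if "Y \<in> ?F" for Y
    proof -
      have "tight (X \<inter> Y)" using X(1) that same by (intro tight_Int_Un) auto
      then show ?thesis using X that by blast
    qed
    then show ?thesis using X(1) by blast
  qed
  show False
  proof (cases "\<exists>X0. tight X0 \<and> u \<in> X0 \<and> v \<notin> X0")
    case True
    then obtain X where X: "tight X" "u \<in> X" "v \<notin> X"
      and Xmax: "\<And>Y. tight Y \<Longrightarrow> u \<in> Y \<Longrightarrow> v \<notin> Y \<Longrightarrow> Y \<subseteq> X" using ex_A by metis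
    show False
    proof (cases "\<exists>X0. tight X0 \<and> v \<in> X0 \<and> u \<notin> X0")
      case True
      then obtain Y where Y: "tight Y" "v \<in> Y" "u \<notin> Y"
        and Ymin: "\<And>Z. tight Z \<Longrightarrow> v \<in> Z \<Longrightarrow> u \<notin> Z \<Longrightarrow> Y \<subseteq> Z" using ex_B by metis
      \<comment> \<open>Every head of an arc leaving \<open>v\<close> lies in the largest set
        \<open>X\<close> or outside the smallest set \<open>Y\<close>. Hence the tight set
        \<open>Y - X\<close> alone blocks every choice of \<open>f\<close>.\<close>
      have "Y \<inter> X \<inter> T = {}" using opposite[OF X(1) Y(1)] X Y by auto
      then have "tight (Y - X)" using tight_Diff X Y by blast
      moreover have "head G f \<notin> Y - X" if "f \<in> arcs G" "tail G f = v" for f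
        using blocked[OF that] Xmax Ymin by blast
      ultimately show False using no_B[of "Y - X"] X Y by blast
    next
      case False
      then show False using no_A[OF X] blocked Xmax by blast
    qed
  next
    case False
    \<comment> \<open>The arc \<open>e\<close> enters \<open>v\<close>, so by balance some arc
      leaves \<open>v\<close>; it supplies a blocking set, necessarily of the second kind.\<close>
    have "in_arcs G v \<noteq> {}" using e by (auto simp: in_arcs_def)
    then have "in_degree G v \<noteq> 0" by (simp add: in_degree_def finite_in_arcs)
    then have "out_arcs G v \<noteq> {}" using degrees_inner[OF v] by (auto simp: out_degree_def)
    then obtain f where "f \<in> arcs G" "tail G f = v" by (auto simp: out_arcs_def)
    then obtain X0 where "tight X0" "v \<in> X0" "u \<notin> X0" using blocked False by blast
    then obtain Y where Y: "tight Y" "v \<in> Y" "u \<notin> Y"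
        and Ymin: "\<And>Z. tight Z \<Longrightarrow> v \<in> Z \<Longrightarrow> u \<notin> Z \<Longrightarrow> Y \<subseteq> Z" using ex_B by metis
    have "head G f \<notin> Y" if "f \<in> arcs G" "tail G f = v" for f
      using blocked[OF that] False Ymin by blast
    then show False using no_B[OF Y] by blast
  qed
qed

section \<open>Symmetric cuts modulo 4\<close>

lemma even_arcs_into_inner:
  assumes X: "X \<subseteq> verts G - T" "\<sigma>V ` X = X"
  shows "even (\<Sum>e \<in> arcs G. of_bool (head G e \<in> X) :: int)"
proof -
  have fin: "finite X" using X finite_subset by fastforce
  have "(\<Sum>e \<in> arcs G. of_bool (head G e \<in> X) :: int) = (\<Sum>e \<in> arcs G. \<Sum>v \<in> X. of_bool (head G e = v))"
    using fin by (intro sum.cong) (auto simp: of_bool_def)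
  also have "\<dots> = (\<Sum>v \<in> X. int (in_degree G v))"
    by (subst sum.swap) (simp add: sum_of_bool_head)
  finally show ?thesis
    \<comment> \<open>The in-degree of \<open>\<sigma>V v\<close> is the out-degree of
      \<open>v\<close>, which for inner \<open>v\<close> is its in-degree, so the weights agree on
      each pair.\<close>
    using even_sum_involution[OF fin, of \<sigma>V "\<lambda>v. int (in_degree G v)"] X
      node_involution node_no_fixpoint in_degree_symmetric degrees_inner by (auto simp: subset_iff)
qed

text \<open>By symmetry as many arcs have their head in \<open>Z\<close> as their tail, so the cut
  has size \<open>2 * (into Z - inside Z)\<close>. The arcs inside \<open>Z\<close> come in
  symmetric pairs, and the inner nodes of \<open>Z\<close> receive an even number of arcs. Hence the
  parity of \<open>into Z - inside Z\<close> depends only on \<open>Z \<inter> T\<close>.\<close>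

lemma cut_size_cong_mod_4:
  assumes "sep X" "sep Y" "X \<inter> T = Y \<inter> T"
  shows "4 dvd cut_size G X - cut_size G Y"
proof -
  define into where "into Z = (\<Sum>e \<in> arcs G. of_bool (head G e \<in> Z) :: int)" for Z
  define inside where "inside Z = (\<Sum>e \<in> arcs G. of_bool (tail G e \<in> Z \<and> head G e \<in> Z) :: int)" for Z
  have size: "cut_size G Z = 2 * into Z - 2 * inside Z" and ev: "even (inside Z)"
    and part: "even (into Z - into (Z \<inter> T))" if "sep Z" for Z
  proof -
    have Z: "Z \<subseteq> verts G" "\<sigma>V ` Z = Z" using that by (auto simp: separating_def)
    have "(\<Sum>e \<in> arcs G. of_bool (tail G e \<in> Z) :: int) = into Z"
      unfolding into_def
      by (rule sum.reindex_bij_witness[of _ \<sigma>E \<sigma>E])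
        (use Z in \<open>auto simp: arc_closed arc_involution head_symmetric symmetric_mem_iff\<close>)
    moreover have "cut_size G Z = (\<Sum>e \<in> arcs G. of_bool (tail G e \<in> Z)) + into Z - 2 * inside Z"
      unfolding cut_size_def into_def inside_def sum_distrib_left sum.distrib[symmetric] sum_subtractf[symmetric]
      by (intro sum.cong) (auto simp: crossing_def)
    ultimately show "cut_size G Z = 2 * into Z - 2 * inside Z" by simp
    show "even (inside Z)"
      unfolding inside_def using Z
      by (intro even_sum_involution[of _ \<sigma>E])
        (auto simp: arc_closed arc_involution arc_no_fixpoint head_symmetric tail_symmetric symmetric_mem_iff)
    have "\<sigma>V ` (Z - T) = Z - T" using Z T_subset T_symmetric by (intro symmetric_Diff)
    then have "even (into (Z - T))"
      using even_arcs_into_inner[of "Z - T"] Z by (auto simp: into_def)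
    moreover have "into Z = into (Z \<inter> T) + into (Z - T)"
      unfolding into_def sum.distrib[symmetric] by (intro sum.cong) auto
    ultimately show "even (into Z - into (Z \<inter> T))" by simp
  qed
  have "even (into X - into Y)" using part[OF assms(1)] part[OF assms(2)] assms(3) by simp
  then have "even (into X - into Y - (inside X - inside Y))" using ev assms(1,2) by simp
  moreover have "cut_size G X - cut_size G Y = 2 * (into X - into Y - (inside X - inside Y))"
    using size assms(1,2) by simp
  ultimately show ?thesis by (metis mult_dvd_mono dvd_refl numeral_Bit0 mult_2)
qed

end

section \<open>Systems of arc-disjoint walks\<close>

text \<open>Taking arc lists as arcs lets a split-off arc carry the walk of \<open>G\<close> that it
  stands for. The symmetry on these arcs is \<open>symmetric_path \<sigma>E\<close>.\<close>

definition walk_graph :: "('a, 'b) pre_digraph \<Rightarrow> 'b list set \<Rightarrow> ('a, 'b list) pre_digraph" where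
  "walk_graph G A = \<lparr>verts = verts G, arcs = A, tail = \<lambda>p. tail G (hd p), head = \<lambda>p. head G (last p)\<rparr>"

lemma walk_graph_simps [simp]:
  "verts (walk_graph G A) = verts G" "arcs (walk_graph G A) = A"
  "tail (walk_graph G A) p = tail G (hd p)" "head (walk_graph G A) p = head G (last p)"
  by (simp_all add: walk_graph_def)

text \<open>
  A walk may pass through its own ends, even if these are terminals; this is repaired only when
  walks are shortened to paths at the very end.
\<close>

definition inner_walk :: "('a, 'b) pre_digraph \<Rightarrow> 'a set \<Rightarrow> 'b list \<Rightarrow> bool" where
  "inner_walk G T p \<longleftrightarrow> p \<noteq> [] \<and> pre_digraph.awalk G (tail G (hd p)) p (head G (last p)) \<and>
     (\<forall>a \<in> set p. {tail G a, head G a} \<inter> T \<subseteq> {tail G (hd p), head G (last p)})"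

text \<open>The invariant of the splitting process. Its first conjunct makes the cut lemmas
  available for the walk graph and excludes closed walks, since the graph is loopless.\<close>

definition walk_system ::
    "('a, 'b) pre_digraph \<Rightarrow> ('a \<Rightarrow> 'a) \<Rightarrow> ('b \<Rightarrow> 'b) \<Rightarrow> 'a set \<Rightarrow> 'b list set \<Rightarrow> bool" where
  "walk_system G \<sigma>V \<sigma>E T A \<longleftrightarrow>
     inner_Eulerian_skew_graph (walk_graph G A) \<sigma>V (symmetric_path \<sigma>E) T \<and>
     arc_disjoint A \<and> (\<forall>p \<in> A. inner_walk G T p)"

text \<open>Balance as a sum over arcs, a form in which the effect of exchanging a few arcs can be
  computed.\<close>

lemma (in fin_digraph) inner_Eulerian_iff:
  "inner_Eulerian G T \<longleftrightarrow>
    (\<forall>v \<in> verts G - T. (\<Sum>e \<in> arcs G. of_bool (head G e = v) - of_bool (tail G e = v) :: int) = 0)"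
  unfolding inner_Eulerian_def sum_subtractf sum_of_bool_head sum_of_bool_tail by simp

lemma hd_symmetric_path: "p \<noteq> [] \<Longrightarrow> hd (symmetric_path \<sigma>E p) = \<sigma>E (last p)"
  by (simp add: symmetric_path_def hd_rev last_map)

lemma last_symmetric_path: "p \<noteq> [] \<Longrightarrow> last (symmetric_path \<sigma>E p) = \<sigma>E (hd p)"
  by (simp add: symmetric_path_def last_rev hd_map)

lemma symmetric_path_append:
  "symmetric_path \<sigma>E (p @ q) = symmetric_path \<sigma>E q @ symmetric_path \<sigma>E p"
  by (simp add: symmetric_path_def)

lemma symmetric_path_eq_Nil [simp]: "symmetric_path \<sigma>E p = [] \<longleftrightarrow> p = []"
  by (simp add: symmetric_path_def)

lemma set_symmetric_path: "set (symmetric_path \<sigma>E p) = \<sigma>E ` set p"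
  by (simp add: symmetric_path_def)

context skew_symmetric_graph
begin

lemma symmetric_path_involution:
  assumes "set p \<subseteq> arcs G"
  shows "symmetric_path \<sigma>E (symmetric_path \<sigma>E p) = p"
  using assms by (auto simp: symmetric_path_def rev_map intro!: map_idI arc_involution)

lemma inner_walk_arcs: "inner_walk G T p \<Longrightarrow> set p \<subseteq> arcs G"
  by (auto simp: inner_walk_def)

lemma tail_symmetric_path:
  assumes "inner_walk G T p"
  shows "tail G (hd (symmetric_path \<sigma>E p)) = \<sigma>V (head G (last p))"
  using assms inner_walk_arcs[OF assms]
  by (auto simp: hd_symmetric_path inner_walk_def intro!: tail_symmetric)

lemma head_symmetric_path:
  assumes "inner_walk G T p"
  shows "head G (last (symmetric_path \<sigma>E p)) = \<sigma>V (tail G (hd p))"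
  using assms inner_walk_arcs[OF assms]
  by (auto simp: last_symmetric_path inner_walk_def intro!: head_symmetric)

lemma inner_walk_symmetric:
  assumes T: "T \<subseteq> verts G" "\<sigma>V ` T = T" and p: "inner_walk G T p"
  shows "inner_walk G T (symmetric_path \<sigma>E p)"
proof -
  have "awalk (\<sigma>V (head G (last p))) (symmetric_path \<sigma>E p) (\<sigma>V (tail G (hd p)))"
    using awalk_symmetric_path p by (auto simp: inner_walk_def)
  moreover have "{tail G a, head G a} \<inter> T \<subseteq> {\<sigma>V (head G (last p)), \<sigma>V (tail G (hd p))}"
    if "a \<in> set (symmetric_path \<sigma>E p)" for a
  proof -
    obtain b where b: "b \<in> set p" "a = \<sigma>E b" using \<open>a \<in> _\<close> by (auto simp: set_symmetric_path)
    then have ba: "b \<in> arcs G" using inner_walk_arcs[OF p] by auto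
    have "{tail G b, head G b} \<inter> T \<subseteq> {tail G (hd p), head G (last p)}"
      using p b by (simp add: inner_walk_def)
    then show ?thesis
      using symmetric_mem_iff[OF T, of "tail G b"] symmetric_mem_iff[OF T, of "head G b"] ba b
      by (auto simp: head_symmetric tail_symmetric)
  qed
  ultimately show ?thesis
    using p tail_symmetric_path[OF p] head_symmetric_path[OF p] by (simp add: inner_walk_def)
qed

text \<open>The joining node is no terminal, so the only terminals met are the start of
  \<open>p\<close> and the end of \<open>q\<close>.\<close>

lemma inner_walk_append:
  assumes p: "inner_walk G T p" and q: "inner_walk G T q"
    and v: "head G (last p) = tail G (hd q)" "head G (last p) \<notin> T"
  shows "inner_walk G T (p @ q)"
proof -
  have "awalk (tail G (hd p)) (p @ q) (head G (last q))"
    using p q v by (auto simp: inner_walk_def)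
  then show ?thesis using p q v by (fastforce simp: inner_walk_def)
qed

text \<open>A joined walk that is closed would be a loop of the walk graph, so it is dropped.\<close>

definition join_walks :: "'b list \<Rightarrow> 'b list \<Rightarrow> 'b list set \<Rightarrow> 'b list set" where
  "join_walks e f A = (A - {e, f, symmetric_path \<sigma>E e, symmetric_path \<sigma>E f}) \<union>
     (if tail G (hd e) = head G (last f) then {} else {e @ f, symmetric_path \<sigma>E (e @ f)})"

text \<open>One splitting step together with its mirror step. Four walks are replaced by at most
  two, which gives the termination measure; the factor 4 arises from a loss of 2 for the joined pair
  and another 2 for its mirror.\<close>

lemma walk_system_join:
  assumes T: "T \<subseteq> verts G" "\<sigma>V ` T = T" and A: "walk_system G \<sigma>V \<sigma>E T A"
    and e: "e \<in> A" and f: "f \<in> A" and v: "head G (last e) = v" "tail G (hd f) = v" "v \<notin> T"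
  shows "walk_system G \<sigma>V \<sigma>E T (join_walks e f A)"
    and "card (join_walks e f A) < card A"
    and "X \<subseteq> verts G \<Longrightarrow> \<sigma>V ` X = X \<Longrightarrow>
      cut_size (walk_graph G (join_walks e f A)) X = cut_size (walk_graph G A) X
        - 4 * (crossing (walk_graph G A) X e * crossing (walk_graph G A) X f)"
proof -
  let ?s = "symmetric_path \<sigma>E"
  let ?B = "join_walks e f A"
  define loop where "loop \<longleftrightarrow> tail G (hd e) = head G (last f)"
  interpret W: inner_Eulerian_skew_graph "walk_graph G A" \<sigma>V ?s T
    using A by (simp add: walk_system_def)
  have inner: "inner_walk G T p" if "p \<in> A" for p using A that by (simp add: walk_system_def)
  have disj: "set p \<inter> set q = {}" if "p \<in> A" "q \<in> A" "p \<noteq> q" for p q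
    using A that by (simp add: walk_system_def arc_disjoint_def)
  have ne: "p \<noteq> []" if "p \<in> A" for p using inner[OF that] by (simp add: inner_walk_def)
  have arcs: "set p \<subseteq> arcs G" if "p \<in> A" for p using inner_walk_arcs[OF inner[OF that]] .
  have fin: "finite A" using W.finite_arcs by simp
  have vV: "v \<in> verts G" using W.head_in_verts[of e] e v by simp
  have closed: "?s p \<in> A" if "p \<in> A" for p using W.arc_closed[of p] that by simp
  have invol: "?s (?s p) = p" if "p \<in> A" for p using W.arc_involution[of p] that by simp
  have nofix: "?s p \<noteq> p" if "p \<in> A" for p using W.arc_no_fixpoint[of p] that by simp
  have "e \<noteq> f" using W.no_loops[of e] e v by auto
  \<comment> \<open>Otherwise \<open>e\<close> would end both at \<open>v\<close> and at
    \<open>\<sigma>V v\<close>.\<close>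
  moreover have "e \<noteq> ?s f"
    using head_symmetric_path[OF inner[OF f]] v node_no_fixpoint[OF vV] by auto
  moreover have "f \<noteq> ?s e" using \<open>e \<noteq> ?s f\<close> invol[OF e] by auto
  moreover have "?s e \<noteq> ?s f" using \<open>e \<noteq> f\<close> invol e f by metis
  ultimately have distinct: "distinct [e, f, ?s e, ?s f]"
    using nofix e f by auto metis+
  have four: "{e, f, ?s e, ?s f} \<subseteq> A" using e f closed by auto
  have ef_inner: "inner_walk G T (e @ f)"
    using inner e f v by (intro inner_walk_append) auto
  have sef_inner: "inner_walk G T (?s (e @ f))"
    using inner_walk_symmetric[OF T ef_inner] .
  have sef: "?s (e @ f) = ?s f @ ?s e" by (rule symmetric_path_append)
  have new: "set (e @ f) \<inter> set p = {}" "set (?s (e @ f)) \<inter> set p = {}"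
    if "p \<in> A - {e, f, ?s e, ?s f}" for p
    using that disj e f closed by (auto simp: sef)
  have new2: "set (e @ f) \<inter> set (?s (e @ f)) = {}"
  proof -
    have "set e \<inter> set (?s e) = {}" "set e \<inter> set (?s f) = {}"
      "set f \<inter> set (?s e) = {}" "set f \<inter> set (?s f) = {}"
      using distinct e f closed by (simp_all add: disj)
    then show ?thesis unfolding sef by auto
  qed
  have ends: "hd (e @ f) = hd e" "last (e @ f) = last f"
    "hd (?s (e @ f)) = hd (?s f)" "last (?s (e @ f)) = last (?s e)"
    using ne e f by (simp_all add: sef)
  have new_neq: "e @ f \<noteq> ?s (e @ f)" using new2 ne[OF e] by auto
  \<comment> \<open>Each new walk shares arcs with a member of \<open>A\<close> from which it
    differs, so disjointness keeps it out of \<open>A\<close>.\<close>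
  have notin: "e @ f \<notin> A" "?s (e @ f) \<notin> A"
  proof -
    have "set (e @ f) \<inter> set e \<noteq> {}" "e @ f \<noteq> e" using ne e f by auto
    then show "e @ f \<notin> A" using disj[OF _ e] by blast
    have "set (?s (e @ f)) \<inter> set (?s e) \<noteq> {}" "?s (e @ f) \<noteq> ?s e"
      using ne e f by (auto simp: sef)
    then show "?s (e @ f) \<notin> A" using disj[OF _ closed[OF e]] by blast
  qed
  have finB: "finite ?B" using fin by (simp add: join_walks_def)
  \<comment> \<open>One bookkeeping identity for all three claims: \<open>g\<close> will be the net
    flow into a node, the constant 1, and the crossing indicator.\<close>
  have sum_B: "sum g ?B = sum g A - (g e + g f + g (?s e) + g (?s f))
      + (if loop then 0 else g (e @ f) + g (?s (e @ f)))" for g :: "'b list \<Rightarrow> int"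
  proof -
    have "sum g ?B = sum g (A - {e, f, ?s e, ?s f}) + (if loop then 0 else g (e @ f) + g (?s (e @ f)))"
      unfolding join_walks_def loop_def using fin notin new_neq
      by (subst sum.union_disjoint) auto
    moreover have "sum g A = sum g (A - {e, f, ?s e, ?s f}) + sum g {e, f, ?s e, ?s f}"
      by (rule sum.subset_diff[OF four fin])
    moreover have "sum g {e, f, ?s e, ?s f} = g e + g f + g (?s e) + g (?s f)"
      using distinct by simp
    ultimately show ?thesis by simp
  qed
  have memB: "p \<in> A - {e, f, ?s e, ?s f} \<or> \<not> loop \<and> (p = e @ f \<or> p = ?s (e @ f))" if "p \<in> ?B" for p
    using that by (auto simp: join_walks_def loop_def split: if_splits)
  have innerB: "inner_walk G T p" if "p \<in> ?B" for p
    using memB[OF that] inner ef_inner sef_inner by auto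
  have disjB: "arc_disjoint ?B"
    unfolding arc_disjoint_def
  proof (intro ballI impI)
    fix p q assume pq: "p \<in> ?B" "q \<in> ?B" "p \<noteq> q"
    show "set p \<inter> set q = {}"
      using memB[OF pq(1)] memB[OF pq(2)] pq(3) new[of p] new[of q] new2 disj[of p q] by blast
  qed
  have sB: "?s p \<in> ?B" if "p \<in> ?B" for p
  proof -
    have "?s p \<in> A - {e, f, ?s e, ?s f}" if p: "p \<in> A - {e, f, ?s e, ?s f}"
      using p closed[of p] invol[of p] invol[OF e] invol[OF f] by auto
    moreover have "?s (?s (e @ f)) = e @ f"
      using symmetric_path_involution[OF inner_walk_arcs[OF ef_inner]] .
    ultimately show ?thesis
      using memB[OF that] by (auto simp: join_walks_def loop_def)
  qed
  have skewB: "skew_symmetric_graph (walk_graph G ?B) \<sigma>V ?s"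
  proof (unfold_locales, simp_all add: finB)
    fix p assume p: "p \<in> ?B"
    note ip = innerB[OF p]
    have "hd p \<in> arcs G" "last p \<in> arcs G"
      using inner_walk_arcs[OF ip] ip by (auto simp: inner_walk_def)
    then show "tail G (hd p) \<in> verts G" "head G (last p) \<in> verts G" by auto
    show "?s p \<in> ?B" using sB[OF p] .
    show "?s (?s p) = p" by (rule symmetric_path_involution[OF inner_walk_arcs[OF ip]])
    show "tail G (hd (?s p)) = \<sigma>V (head G (last p))" "head G (last (?s p)) = \<sigma>V (tail G (hd p))"
      using tail_symmetric_path[OF ip] head_symmetric_path[OF ip] .
    show "?s p \<noteq> p"
      using memB[OF p] nofix[of p] new_neq symmetric_path_involution[OF inner_walk_arcs[OF ef_inner]]
      by auto
    show "tail G (hd p) \<noteq> head G (last p)"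
    proof -
      have "tail G (hd p) \<noteq> head G (last p)" if "p \<in> A" using W.no_loops[of p] that by simp
      moreover have "tail G (hd (e @ f)) \<noteq> head G (last (e @ f))" if "\<not> loop"
        using that by (simp add: ends loop_def)
      moreover have "tail G (hd (?s (e @ f))) \<noteq> head G (last (?s (e @ f)))" if "\<not> loop"
      proof -
        have "tail G (hd e) \<in> verts G" "head G (last f) \<in> verts G"
          using W.tail_in_verts[of e] W.head_in_verts[of f] e f by auto
        then show ?thesis
          using that inj_on_contraD[OF inj_on_nodes]
          unfolding tail_symmetric_path[OF ef_inner] head_symmetric_path[OF ef_inner]
          by (simp add: ends(1,2) loop_def)
      qed
      ultimately show ?thesis using memB[OF p] by auto
    qed
  qed (auto simp: node_closed node_involution node_no_fixpoint)
  then interpret B: skew_symmetric_graph "walk_graph G ?B" \<sigma>V ?s .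
  have "inner_Eulerian (walk_graph G ?B) T"
    unfolding B.inner_Eulerian_iff
  proof (simp, intro ballI)
    fix x assume x: "x \<in> verts G - T"
    define g where "g p = (of_bool (head G (last p) = x) - of_bool (tail G (hd p) = x) :: int)" for p
    have join: "g (e @ f) = g e + g f" using v by (simp add: g_def ends)
    have "head G (last (?s f)) = tail G (hd (?s e))"
      using tail_symmetric_path[OF inner[OF e]] head_symmetric_path[OF inner[OF f]] v by simp
    then have join_s: "g (?s (e @ f)) = g (?s e) + g (?s f)" by (simp add: g_def ends)
    \<comment> \<open>A closed walk has no net flow at any node, so dropping it preserves
      balance.\<close>
    have loop: "g (e @ f) = 0 \<and> g (?s (e @ f)) = 0" if loop
      using that unfolding g_def tail_symmetric_path[OF ef_inner] head_symmetric_path[OF ef_inner]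
      by (simp add: ends(1,2) loop_def)
    have "sum g ?B = sum g A"
      using sum_B[of g] loop join join_s by (cases loop) auto
    also have "\<dots> = 0"
      using W.Eulerian x unfolding W.inner_Eulerian_iff by (simp add: g_def)
    finally show "(\<Sum>p \<in> ?B. of_bool (head G (last p) = x) - of_bool (tail G (hd p) = x) :: int) = 0"
      by (simp only: g_def[abs_def])
  qed
  then have "inner_Eulerian_skew_graph (walk_graph G ?B) \<sigma>V ?s T"
    using T by unfold_locales auto
  then show "walk_system G \<sigma>V \<sigma>E T ?B"
    using disjB innerB by (simp add: walk_system_def)
  show "card ?B < card A"
    using sum_B[of "\<lambda>_. 1"] finB fin by (simp split: if_splits)
  show "cut_size (walk_graph G ?B) X = cut_size (walk_graph G A) X
        - 4 * (crossing (walk_graph G A) X e * crossing (walk_graph G A) X f)"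
    if X: "X \<subseteq> verts G" "\<sigma>V ` X = X"
  proof -
    let ?c = "\<lambda>p. of_bool ((tail G (hd p) \<in> X) \<noteq> (head G (last p) \<in> X)) :: int"
    have c_s: "?c (?s p) = ?c p" if p: "inner_walk G T p" for p
    proof -
      have "hd p \<in> arcs G" "last p \<in> arcs G"
        using inner_walk_arcs[OF p] p by (auto simp: inner_walk_def)
      then show ?thesis
        using X by (auto simp: tail_symmetric_path[OF p] head_symmetric_path[OF p] symmetric_mem_iff)
    qed
    have "loop \<Longrightarrow> ?c (e @ f) = 0" by (simp add: ends loop_def)
    then have "sum ?c ?B = sum ?c A - 2 * (?c e + ?c f - ?c (e @ f))"
      unfolding sum_B c_s[OF inner[OF e]] c_s[OF inner[OF f]] c_s[OF ef_inner] by simp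
    \<comment> \<open>The joined walk crosses exactly if one of its two parts does, so a loss occurs
      only when both parts cross.\<close>
    also have "?c e + ?c f - ?c (e @ f) = 2 * (?c e * ?c f)"
      using v by (simp add: ends)
    finally show ?thesis by (simp add: cut_size_def crossing_def)
  qed
qed

text \<open>The starting point of the splitting process: a copy of \<open>G\<close> in which every
  arc is a walk of length one.\<close>

lemma walk_system_singletons:
  assumes T: "T \<subseteq> verts G" "\<sigma>V ` T = T" and "inner_Eulerian G T"
  shows "walk_system G \<sigma>V \<sigma>E T ((\<lambda>e. [e]) ` arcs G)"
    and "cut_size (walk_graph G ((\<lambda>e. [e]) ` arcs G)) X = cut_size G X"
proof -
  let ?A = "(\<lambda>e. [e]) ` arcs G" and ?s = "symmetric_path \<sigma>E"
  have inj: "inj_on (\<lambda>e. [e]) (arcs G)" by (simp add: inj_on_def)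
  have "skew_symmetric_graph (walk_graph G ?A) \<sigma>V ?s"
    by unfold_locales
      (auto simp: symmetric_path_def arc_closed arc_involution arc_no_fixpoint no_loops
        node_closed node_involution node_no_fixpoint tail_symmetric head_symmetric)
  then interpret W: skew_symmetric_graph "walk_graph G ?A" \<sigma>V ?s .
  have "inner_Eulerian (walk_graph G ?A) T"
    using assms(3) unfolding W.inner_Eulerian_iff inner_Eulerian_iff
    by (simp add: sum.reindex[OF inj])
  then have "inner_Eulerian_skew_graph (walk_graph G ?A) \<sigma>V ?s T"
    using T by unfold_locales auto
  moreover have "inner_walk G T [e]" if "e \<in> arcs G" for e
    using that by (auto simp: inner_walk_def arc_implies_awalk awalk_simps)
  ultimately show "walk_system G \<sigma>V \<sigma>E T ?A"
    by (auto simp: walk_system_def arc_disjoint_def)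
  show "cut_size (walk_graph G ?A) X = cut_size G X"
    by (simp add: cut_size_def crossing_def sum.reindex[OF inj])
qed

text \<open>
  Joining lowers a symmetric cut by 0 or 4. The congruence modulo 4 makes a lowered cut stay above
  the bound unless it was tight, which is why only tight sets can block.
\<close>

lemma ex_terminal_walk_system:
  fixes l :: "'a set \<Rightarrow> int"
  assumes T: "T \<subseteq> verts G" "\<sigma>V ` T = T" and "walk_system G \<sigma>V \<sigma>E T A"
    and "\<And>X. separating G \<sigma>V T X \<Longrightarrow>
      l (X \<inter> T) \<le> cut_size (walk_graph G A) X \<and> 4 dvd cut_size (walk_graph G A) X - l (X \<inter> T)"
  shows "\<exists>B. walk_system G \<sigma>V \<sigma>E T B \<and>
    (\<forall>p \<in> B. tail G (hd p) \<in> T \<and> head G (last p) \<in> T) \<and>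
    (\<forall>X. separating G \<sigma>V T X \<longrightarrow> l (X \<inter> T) \<le> cut_size (walk_graph G B) X)"
  using assms(3,4)
proof (induction "card A" arbitrary: A rule: less_induct)
  case less
  let ?W = "walk_graph G A" and ?s = "symmetric_path \<sigma>E"
  interpret W: inner_Eulerian_skew_graph ?W \<sigma>V ?s T
    using less.prems(1) by (simp add: walk_system_def)
  have sep_W: "separating (walk_graph G C) \<sigma>V T X \<longleftrightarrow> separating G \<sigma>V T X" for C X
    by (simp add: separating_def)
  show ?case
  proof (cases "\<forall>p \<in> A. head G (last p) \<in> T")
    case True
    \<comment> \<open>The tail of \<open>p\<close> is mirrored to the head of the symmetric walk,
      which is a terminal.\<close>
    have "tail G (hd p) \<in> T" if p: "p \<in> A" for p
    proof -
      have "\<sigma>V (tail G (hd p)) \<in> T"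
        using True W.arc_closed[of p] W.head_symmetric[of p] p by auto
      moreover have "tail G (hd p) \<in> verts G" using W.tail_in_verts[of p] p by simp
      ultimately show ?thesis using symmetric_mem_iff[OF T] by blast
    qed
    then show ?thesis using True less.prems by blast
  next
    case False
    then obtain e where e: "e \<in> A" "head G (last e) \<notin> T" by blast
    let ?v = "head G (last e)"
    have "\<exists>f \<in> arcs ?W. tail ?W f = ?v \<and>
      (\<forall>X. W.sep X \<longrightarrow> cut_size ?W X = l (X \<inter> T) \<longrightarrow> crossing ?W X e = 0 \<or> crossing ?W X f = 0)"
      using e less.prems(2) by (intro W.ex_unblocked_arc) (auto simp: sep_W)
    then obtain f where f: "f \<in> A" "tail G (hd f) = ?v"
      and free: "\<And>X. separating G \<sigma>V T X \<Longrightarrow> cut_size ?W X = l (X \<inter> T) \<Longrightarrow>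
        crossing ?W X e = 0 \<or> crossing ?W X f = 0"
      by (auto simp: sep_W)
    note join = walk_system_join[OF T less.prems(1) e(1) f(1) refl f(2) e(2)]
    show ?thesis
    proof (rule less.hyps[OF join(2,1)])
      fix X assume X: "separating G \<sigma>V T X"
      then have "X \<subseteq> verts G" "\<sigma>V ` X = X" by (auto simp: separating_def)
      note cut = join(3)[OF this]
      have "l (X \<inter> T) \<le> cut_size ?W X" "4 dvd cut_size ?W X - l (X \<inter> T)"
        using less.prems(2)[OF X] by auto
      moreover have "crossing ?W X e * crossing ?W X f = 0
          \<or> crossing ?W X e * crossing ?W X f = 1 \<and> cut_size ?W X \<noteq> l (X \<inter> T)"
        using free[OF X] by (auto simp: crossing_def)
      \<comment> \<open>If \<open>c = 1\<close>, then \<open>d > b\<close> and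
        \<open>4 dvd d - b\<close> give \<open>d \<ge> b + 4\<close>.\<close>
      moreover have "b \<le> d - 4 * c \<and> 4 dvd d - 4 * c - b"
        if "b \<le> d" "4 dvd d - b" "c = 0 \<or> c = 1 \<and> d \<noteq> b" for b c d :: int
        using that by (elim disjE conjE) (simp, presburger)
      ultimately show "l (X \<inter> T) \<le> cut_size (walk_graph G (join_walks e f A)) X \<and>
          4 dvd cut_size (walk_graph G (join_walks e f A)) X - l (X \<inter> T)"
        unfolding cut by blast
    qed
  qed
qed

end

section \<open>Essential packings\<close>

text \<open>
  The shortening of walks to paths need not commute with the symmetry, so it is applied to one
  member of each symmetric pair only and transported to the other.
\<close>

lemma ex_symmetric_choice:
  assumes closed: "\<And>p. p \<in> A \<Longrightarrow> s p \<in> A \<and> s (s p) = p \<and> s p \<noteq> p"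
    and g: "\<And>p. p \<in> A \<Longrightarrow> s' (s' (g p)) = g p"
  shows "\<exists>f. \<forall>p \<in> A. f (s p) = s' (f p) \<and> (f p = g p \<or> f p = s' (g (s p)))"
proof -
  \<comment> \<open>The choice depends only on the unordered pair, so \<open>p\<close> and
    \<open>s p\<close> get the same representative.\<close>
  define r where "r p = (SOME x. x \<in> {p, s p})" for p
  define f where "f p = (if r p = p then g p else s' (g (s p)))" for p
  have "f (s p) = s' (f p) \<and> (f p = g p \<or> f p = s' (g (s p)))" if p: "p \<in> A" for p
  proof -
    have "{s p, s (s p)} = {p, s p}" using closed[OF p] by auto
    then have rs: "r (s p) = r p" by (simp add: r_def)
    have "r p \<in> {p, s p}" unfolding r_def by (rule someI[of _ p]) simp
    then show ?thesis
      using rs closed[OF p] g[of "s p"] by (auto simp: f_def)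
  qed
  then show ?thesis by blast
qed

context skew_symmetric_graph
begin

text \<open>Cutting out cycles uses only arcs of \<open>p\<close>, whose terminal ends are among
  \<open>s\<close> and \<open>t\<close>; a simple path visits these two only at its ends.\<close>

lemma T_path_awalk_to_apath:
  assumes p: "inner_walk G T p" and st: "tail G (hd p) = s" "head G (last p) = t"
    and T: "s \<in> T" "t \<in> T" "s \<noteq> t"
  shows "T_path G T s (awalk_to_apath p) t" and "set (awalk_to_apath p) \<subseteq> set p"
proof -
  let ?q = "awalk_to_apath p"
  have w: "awalk s p t" using p st by (simp add: inner_walk_def)
  then have q: "apath s ?q t" by (rule apath_awalk_to_apath)
  show sub: "set ?q \<subseteq> set p" using w by (rule awalk_to_apath_subset)
  have qw: "awalk s ?q t" using q by (simp add: apath_def)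
  then have "?q \<noteq> []" using T(3) by (auto simp: awalk_Nil_iff)
  moreover have "cas s ?q t" using qw by (simp add: awalk_def)
  ultimately have "set (awalk_verts s ?q) = tail G ` set ?q \<union> head G ` set ?q"
    by (auto simp: set_awalk_verts_not_Nil_cas)
  moreover have "{tail G a, head G a} \<inter> T \<subseteq> {s, t}" "{tail G a, head G a} \<subseteq> verts G"
    if "a \<in> set ?q" for a
    using that sub p inner_walk_arcs[OF p] st by (auto simp: inner_walk_def)
  ultimately have "set (awalk_verts s ?q) - {s, t} \<subseteq> verts G - T" by auto
  then show "T_path G T s ?q t" using q T by (simp add: T_path_def)
qed

lemma T_path_symmetric:
  assumes T: "T \<subseteq> verts G" "\<sigma>V ` T = T" and p: "T_path G T s p t"
  shows "T_path G T (\<sigma>V t) (symmetric_path \<sigma>E p) (\<sigma>V s)"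
proof -
  note inj = inj_on_nodes
  have st: "s \<in> verts G" "t \<in> verts G" "s \<noteq> t" using p T by (auto simp: T_path_def)
  have w: "awalk s p t" "distinct (awalk_verts s p)"
    using p by (auto simp: T_path_def apath_def)
  then have V: "set (awalk_verts s p) \<subseteq> verts G" by auto
  note sw = awalk_symmetric_path[OF w(1)]
  have "distinct (awalk_verts (\<sigma>V t) (symmetric_path \<sigma>E p))"
    using sw w(2) inj_on_subset[OF inj V] by (simp add: distinct_map)
  then have "apath (\<sigma>V t) (symmetric_path \<sigma>E p) (\<sigma>V s)" using sw by (simp add: apath_def)
  moreover have "set (awalk_verts (\<sigma>V t) (symmetric_path \<sigma>E p)) - {\<sigma>V t, \<sigma>V s} \<subseteq> verts G - T"
    using sw p V symmetric_mem_iff[OF T] node_closed by (auto simp: T_path_def)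
  moreover have "\<sigma>V t \<noteq> \<sigma>V s" using st inj by (auto dest: inj_onD)
  ultimately show ?thesis using p T by (auto simp: T_path_def)
qed

lemma essential_T_path_symmetric:
  assumes T: "T \<subseteq> verts G" "\<sigma>V ` T = T" and p: "essential_T_path G \<sigma>V T p"
  shows "essential_T_path G \<sigma>V T (symmetric_path \<sigma>E p)"
proof -
  obtain s t where st: "T_path G T s p t" "t \<noteq> \<sigma>V s" using p by (auto simp: essential_T_path_def)
  have "t \<in> verts G" using st T by (auto simp: T_path_def)
  then have "\<sigma>V s \<noteq> \<sigma>V (\<sigma>V t)" using st node_involution by simp
  then show ?thesis using T_path_symmetric[OF T st(1)] by (auto simp: essential_T_path_def)
qed

text \<open>Every walk is replaced by a path within its own arcs, so disjointness is inherited and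
  no two walks yield the same path.\<close>

lemma ex_essential_packing:
  assumes T: "T \<subseteq> verts G" "\<sigma>V ` T = T" and A: "walk_system G \<sigma>V \<sigma>E T A"
    and ends: "\<And>p. p \<in> A \<Longrightarrow> tail G (hd p) \<in> T \<and> head G (last p) \<in> T"
  shows "\<exists>P \<in> essential_packings G \<sigma>V \<sigma>E T.
    card P = card {p \<in> A. head G (last p) \<noteq> \<sigma>V (tail G (hd p))}"
proof -
  let ?s = "symmetric_path \<sigma>E"
  let ?A = "{p \<in> A. head G (last p) \<noteq> \<sigma>V (tail G (hd p))}"
  interpret W: inner_Eulerian_skew_graph "walk_graph G A" \<sigma>V ?s T
    using A by (simp add: walk_system_def)
  have inner: "inner_walk G T p" if "p \<in> A" for p using A that by (simp add: walk_system_def)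
  have disj: "set p \<inter> set q = {}" if "p \<in> A" "q \<in> A" "p \<noteq> q" for p q
    using A that by (simp add: walk_system_def arc_disjoint_def)
  have path: "essential_T_path G \<sigma>V T (awalk_to_apath p)" "set (awalk_to_apath p) \<subseteq> set p"
    if p: "p \<in> ?A" for p
  proof -
    have "tail G (hd p) \<noteq> head G (last p)" using W.no_loops[of p] p by simp
    then have "T_path G T (tail G (hd p)) (awalk_to_apath p) (head G (last p))"
      "set (awalk_to_apath p) \<subseteq> set p"
      using T_path_awalk_to_apath[OF inner refl refl] p ends[of p] by auto
    then show "essential_T_path G \<sigma>V T (awalk_to_apath p)" "set (awalk_to_apath p) \<subseteq> set p"
      using p by (auto simp: essential_T_path_def)
  qed
  have sA: "?s p \<in> ?A" if p: "p \<in> ?A" for p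
  proof -
    have "head G (last p) \<in> verts G" "tail G (hd p) \<in> verts G" using ends[of p] p T by auto
    moreover have "?s p \<in> A" using W.arc_closed[of p] p by simp
    ultimately show ?thesis
      using p node_involution tail_symmetric_path[OF inner] head_symmetric_path[OF inner] by auto
  qed
  have arcs: "set p \<subseteq> arcs G" if "p \<in> A" for p using inner_walk_arcs[OF inner[OF that]] .
  \<comment> \<open>A shortening \<open>f\<close> that commutes with the symmetry makes the
    resulting collection symmetric.\<close>
  have "\<exists>f. \<forall>p \<in> ?A. f (?s p) = ?s (f p) \<and> (f p = awalk_to_apath p \<or> f p = ?s (awalk_to_apath (?s p)))"
  proof (rule ex_symmetric_choice)
    fix p assume p: "p \<in> ?A"
    show "?s p \<in> ?A \<and> ?s (?s p) = p \<and> ?s p \<noteq> p"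
      using sA[OF p] W.arc_involution[of p] W.arc_no_fixpoint[of p] p by simp
    show "?s (?s (awalk_to_apath p)) = awalk_to_apath p"
      using path(2)[OF p] arcs[of p] p by (intro symmetric_path_involution) auto
  qed
  then obtain f where fs: "\<And>p. p \<in> ?A \<Longrightarrow> f (?s p) = ?s (f p)"
    and f: "\<And>p. p \<in> ?A \<Longrightarrow> f p = awalk_to_apath p \<or> f p = ?s (awalk_to_apath (?s p))" by blast
  have ess: "essential_T_path G \<sigma>V T (f p)" if p: "p \<in> ?A" for p
    using f[OF p] path(1)[OF p] path(1)[OF sA[OF p]] essential_T_path_symmetric[OF T] by metis
  have sub: "set (f p) \<subseteq> set p" if p: "p \<in> ?A" for p
  proof -
    have "set (?s (awalk_to_apath (?s p))) \<subseteq> set (?s (?s p))"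
      using path(2)[OF sA[OF p]] by (auto simp: set_symmetric_path)
    then show ?thesis using f[OF p] path(2)[OF p] W.arc_involution[of p] p by auto
  qed
  have ne: "f p \<noteq> []" if p: "p \<in> ?A" for p
    using ess[OF p] by (auto simp: essential_T_path_def T_path_def apath_Nil_iff)
  have sep: "set (f p) \<inter> set (f q) = {}" if "p \<in> ?A" "q \<in> ?A" "p \<noteq> q" for p q
    using sub[OF that(1)] sub[OF that(2)] disj[of p q] that by blast
  have "inj_on f ?A"
  proof (rule inj_onI, rule ccontr)
    fix p q assume pq: "p \<in> ?A" "q \<in> ?A" "f p = f q" "p \<noteq> q"
    then show False using sep[OF pq(1,2,4)] ne[OF pq(1)] by simp
  qed
  then have "card (f ` ?A) = card ?A" by (rule card_image)
  moreover have "symmetric_collection \<sigma>E (f ` ?A)"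
  proof -
    have "?s ` f ` ?A = f ` ?s ` ?A" unfolding image_image using fs by (intro image_cong) auto
    moreover have "?s ` ?A = ?A"
    proof
      show "?s ` ?A \<subseteq> ?A" using sA by blast
      show "?A \<subseteq> ?s ` ?A"
      proof
        fix p assume p: "p \<in> ?A"
        have "?s (?s p) = p" using W.arc_involution[of p] p by simp
        then show "p \<in> ?s ` ?A" by (intro image_eqI[OF _ sA[OF p]]) (rule sym)
      qed
    qed
    ultimately show ?thesis by (simp add: symmetric_collection_def)
  qed
  moreover have "arc_disjoint (f ` ?A)" unfolding arc_disjoint_def using sep by blast
  ultimately show ?thesis
    using ess by (intro bexI[of _ "f ` ?A"]) (auto simp: essential_packings_def)
qed

section \<open>Counting essential paths against cuts\<close>

lemma awalk_meets_cut:
  assumes "awalk u p v" "(u \<in> X) \<noteq> (v \<in> X)"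
  shows "set p \<inter> cut G X \<noteq> {}"
  using assms
proof (induction p arbitrary: u)
  case (Cons e p)
  then have e: "e \<in> arcs G" "tail G e = u" "awalk (head G e) p v" by (auto simp: awalk_Cons_iff)
  show ?case
  proof (cases "(head G e \<in> X) = (u \<in> X)")
    case True
    then show ?thesis using Cons.IH[OF e(3)] Cons.prems(2) by auto
  next
    case False
    then have "e \<in> cut G X" using e by (auto simp: cut_def)
    then show ?thesis by auto
  qed
qed (auto simp: awalk_Nil_iff)

end

text \<open>Picking an arc of \<open>C\<close> on each path is injective, because distinct paths
  share no arc.\<close>

lemma card_meeting_le:
  assumes "arc_disjoint P" "finite C"
  shows "card {p \<in> P. set p \<inter> C \<noteq> {}} \<le> card C"
proof (rule card_inj_on_le)
  let ?f = "\<lambda>p. SOME a. a \<in> set p \<inter> C"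
  have f: "?f p \<in> set p \<inter> C" if "set p \<inter> C \<noteq> {}" for p
    by (rule someI_ex) (use that in blast)
  show "?f ` {p \<in> P. set p \<inter> C \<noteq> {}} \<subseteq> C" using f by auto
  show "inj_on ?f {p \<in> P. set p \<inter> C \<noteq> {}}"
  proof (rule inj_onI, rule ccontr)
    fix p q assume pq: "p \<in> {p \<in> P. set p \<inter> C \<noteq> {}}" "q \<in> {p \<in> P. set p \<inter> C \<noteq> {}}"
      "?f p = ?f q" "p \<noteq> q"
    then have "?f p \<in> set p \<inter> set q" using f[of p] f[of q] by auto
    then show False using pq assms(1) by (auto simp: arc_disjoint_def)
  qed
qed (rule assms(2))

context inner_Eulerian_skew_graph
begin

text \<open>\<open>S\<close> is a transversal, so the pairs \<open>{s, \<sigma>V s}\<close>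
  partition \<open>T\<close>.\<close>

lemma sum_terminal_pairs:
  assumes S: "T = S \<union> \<sigma>V ` S" "S \<inter> \<sigma>V ` S = {}" and x: "x \<in> T"
  shows "(\<Sum>s \<in> S. of_bool (x \<in> {s, \<sigma>V s}) :: int) = 1"
proof -
  have fin: "finite S" using S T_subset finite_subset[of S "verts G"] by auto
  obtain r where r: "r \<in> S" "x = r \<or> x = \<sigma>V r" using S x by auto
  have "x \<in> {s, \<sigma>V s} \<longleftrightarrow> s = r" if s: "s \<in> S" for s
  proof -
    have "\<sigma>V (\<sigma>V s) = s" "\<sigma>V (\<sigma>V r) = r" using s r S T_subset node_involution by auto
    then have "\<sigma>V s = \<sigma>V r \<Longrightarrow> s = r" by metis
    moreover have "s \<noteq> \<sigma>V r" "r \<noteq> \<sigma>V s" using s r S by auto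
    ultimately show ?thesis using r(2) unfolding insert_iff empty_iff by metis
  qed
  then have "(\<Sum>s \<in> S. of_bool (x \<in> {s, \<sigma>V s}) :: int) = (\<Sum>s \<in> S. of_bool (s = r))"
    by (intro sum.cong) auto
  also have "\<dots> = 1" using fin r by (simp add: of_bool_def)
  finally show ?thesis .
qed

text \<open>An arc between symmetric terminals has both ends or neither in each pair and crosses no
  pair cut; any other arc crosses at most the two cuts at the pairs of its ends.\<close>

lemma sum_cuts_le_essential:
  assumes S: "T = S \<union> \<sigma>V ` S" "S \<inter> \<sigma>V ` S = {}"
    and A: "\<And>p. p \<in> arcs G \<Longrightarrow> tail G p \<in> T \<and> head G p \<in> T"
  shows "(\<Sum>s \<in> S. cut_size G {s, \<sigma>V s}) \<le> 2 * int (card {p \<in> arcs G. head G p \<noteq> \<sigma>V (tail G p)})"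
proof -
  have "(\<Sum>s \<in> S. crossing G {s, \<sigma>V s} p) \<le> 2 * of_bool (head G p \<noteq> \<sigma>V (tail G p))"
    if p: "p \<in> arcs G" for p
  proof (cases "head G p = \<sigma>V (tail G p)")
    case True
    have "crossing G {s, \<sigma>V s} p = 0" if "s \<in> S" for s
    proof -
      have "{s, \<sigma>V s} \<subseteq> verts G" "\<sigma>V ` {s, \<sigma>V s} = {s, \<sigma>V s}"
        using that S T_subset node_involution by auto
      then show ?thesis using symmetric_mem_iff[of "{s, \<sigma>V s}" "tail G p"] p True
        unfolding crossing_def by simp
    qed
    then show ?thesis by simp
  next
    case False
    have "(\<Sum>s \<in> S. crossing G {s, \<sigma>V s} p)
        \<le> (\<Sum>s \<in> S. of_bool (tail G p \<in> {s, \<sigma>V s}) + of_bool (head G p \<in> {s, \<sigma>V s}))"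
      by (intro sum_mono) (auto simp: crossing_def)
    also have "\<dots> = 2"
      unfolding sum.distrib using sum_terminal_pairs[OF S] A[OF p] by simp
    finally show ?thesis using False by simp
  qed
  then have "(\<Sum>p \<in> arcs G. \<Sum>s \<in> S. crossing G {s, \<sigma>V s} p)
      \<le> (\<Sum>p \<in> arcs G. 2 * of_bool (head G p \<noteq> \<sigma>V (tail G p)))"
    by (rule sum_mono)
  also have "\<dots> = 2 * int (card {p \<in> arcs G. head G p \<noteq> \<sigma>V (tail G p)})"
    by (simp add: sum_distrib_left[symmetric] of_bool_def sum.If_cases Int_def)
  finally show ?thesis unfolding cut_size_def by (subst sum.swap)
qed

text \<open>The ends of an essential path lie in two different pairs, so the path meets the cuts of
  both; a cut is met by at most as many disjoint paths as it has arcs.\<close>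

lemma packing_le_sum_cuts:
  assumes S: "T = S \<union> \<sigma>V ` S" "S \<inter> \<sigma>V ` S = {}"
    and P: "P \<in> essential_packings G \<sigma>V \<sigma>E T"
    and X: "\<And>s. s \<in> S \<Longrightarrow> X s \<subseteq> verts G \<and> X s \<inter> T = {s, \<sigma>V s}"
  shows "2 * int (card P) \<le> (\<Sum>s \<in> S. int (card (cut G (X s))))"
proof -
  have ess: "essential_T_path G \<sigma>V T p" if "p \<in> P" for p
    using P that by (simp add: essential_packings_def)
  have "\<exists>s t. T_path G T s p t \<and> t \<noteq> \<sigma>V s" if "p \<in> P" for p
    using ess[OF that] by (auto simp: essential_T_path_def)
  then obtain a b where ab: "\<And>p. p \<in> P \<Longrightarrow> T_path G T (a p) p (b p) \<and> b p \<noteq> \<sigma>V (a p)" by metis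
  have fin: "finite P"
  proof -
    have "P \<subseteq> (\<lambda>(u, p, v). p) ` {(u, p, v). apath u p v}"
      using ab by (force simp: T_path_def)
    then show ?thesis using finite_subset finite_imageI[OF apaths_finite_triple] by blast
  qed
  \<comment> \<open>The left side is at most 1: two distinct ends in the same pair would be
    symmetric to each other.\<close>
  have meet: "of_bool (a p \<in> {s, \<sigma>V s}) + of_bool (b p \<in> {s, \<sigma>V s})
      \<le> (of_bool (set p \<inter> cut G (X s) \<noteq> {}) :: int)" if p: "p \<in> P" and s: "s \<in> S" for p s
  proof -
    have w: "a p \<in> T" "b p \<in> T" "a p \<noteq> b p" "awalk (a p) p (b p)" "b p \<noteq> \<sigma>V (a p)"
      using ab[OF p] by (auto simp: T_path_def apath_def)
    have "\<sigma>V (\<sigma>V s) = s" using s S T_subset node_involution by auto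
    then have "\<not> (a p \<in> {s, \<sigma>V s} \<and> b p \<in> {s, \<sigma>V s})" using w by auto
    moreover have "a p \<in> X s \<longleftrightarrow> a p \<in> {s, \<sigma>V s}" "b p \<in> X s \<longleftrightarrow> b p \<in> {s, \<sigma>V s}"
      using X[OF s] w by blast+
    ultimately show ?thesis using awalk_meets_cut[OF w(4), of "X s"] by (auto simp: of_bool_def)
  qed
  have "2 * int (card P) = (\<Sum>p \<in> P. \<Sum>s \<in> S. of_bool (a p \<in> {s, \<sigma>V s}) + of_bool (b p \<in> {s, \<sigma>V s}))"
    unfolding sum.distrib using sum_terminal_pairs[OF S] ab by (simp add: T_path_def)
  also have "\<dots> \<le> (\<Sum>p \<in> P. \<Sum>s \<in> S. of_bool (set p \<inter> cut G (X s) \<noteq> {}))"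
    using meet by (intro sum_mono)
  also have "\<dots> = (\<Sum>s \<in> S. int (card {p \<in> P. set p \<inter> cut G (X s) \<noteq> {}}))"
    using fin by (subst sum.swap) (simp add: of_bool_def sum.If_cases Int_def)
  also have "\<dots> \<le> (\<Sum>s \<in> S. int (card (cut G (X s))))"
    using P by (intro sum_mono) (auto simp: essential_packings_def cut_def intro!: card_meeting_le)
  finally show ?thesis .
qed

section \<open>The min-max equality over the integers\<close>

lemma max_essential_packing_eq:
  assumes S: "T = S \<union> \<sigma>V ` S" "S \<inter> \<sigma>V ` S = {}"
  shows "2 * int (max_essential_packing G \<sigma>V \<sigma>E T) = (\<Sum>s \<in> S. int (min_symmetric_cut G \<sigma>V T s))"
proof (rule antisym)
  note packings = essential_packings_finite_nonempty[of T]
  \<comment> \<open>Indexing by the terminal set \<open>D\<close> instead of \<open>s\<close> gives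
    the bound the form \<open>l (X \<inter> T)\<close> required for splitting.\<close>
  define cuts where "cuts D = {cut G X | X. X \<subseteq> verts G \<and> \<sigma>V ` X = X \<and> X \<inter> T = D}" for D
  define l where "l D = int (Min (card ` cuts D))" for D
  have l_min: "l {s, \<sigma>V s} = int (min_symmetric_cut G \<sigma>V T s)" for s
    by (simp add: l_def cuts_def min_symmetric_cut_def separating_symmetric_cuts_def)
  have fin: "finite (cuts D)" for D
    by (rule finite_subset[of _ "Pow (arcs G)"]) (auto simp: cuts_def cut_def)
  have l_le: "l (X \<inter> T) \<le> cut_size G X" if "sep X" for X
  proof -
    have "cut G X \<in> cuts (X \<inter> T)" using that by (auto simp: cuts_def separating_def)
    then have "Min (card ` cuts (X \<inter> T)) \<le> card (cut G X)" using fin by simp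
    moreover have "X \<subseteq> verts G" using that by (simp add: separating_def)
    ultimately show ?thesis using card_cut[of X] by (simp add: l_def)
  qed
  have l_attained: "\<exists>Y. sep Y \<and> Y \<inter> T = X \<inter> T \<and> int (card (cut G Y)) = l (X \<inter> T)" if "sep X" for X
  proof -
    have "cut G X \<in> cuts (X \<inter> T)" using that by (auto simp: cuts_def separating_def)
    then have "Min (card ` cuts (X \<inter> T)) \<in> card ` cuts (X \<inter> T)"
      using fin by (intro Min_in) auto
    then obtain Y where "Y \<subseteq> verts G" "\<sigma>V ` Y = Y" "Y \<inter> T = X \<inter> T"
      "Min (card ` cuts (X \<inter> T)) = card (cut G Y)" by (auto simp: cuts_def)
    then show ?thesis using that by (intro exI[of _ Y]) (auto simp: separating_def l_def)
  qed
  have sep_pair: "sep {s, \<sigma>V s}" "{s, \<sigma>V s} \<inter> T = {s, \<sigma>V s}" if "s \<in> S" for s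
  proof -
    have s: "s \<in> T" "\<sigma>V s \<in> T" using that S by auto
    then show eq: "{s, \<sigma>V s} \<inter> T = {s, \<sigma>V s}" by auto
    have "\<sigma>V ` {s, \<sigma>V s} = {s, \<sigma>V s}" using s T_subset node_involution[of s] by auto
    then show "sep {s, \<sigma>V s}" using s T_subset eq unfolding separating_def by blast
  qed

  have "Max (card ` essential_packings G \<sigma>V \<sigma>E T) \<in> card ` essential_packings G \<sigma>V \<sigma>E T"
    using packings by (intro Max_in) auto
  then obtain P where P: "P \<in> essential_packings G \<sigma>V \<sigma>E T"
    "max_essential_packing G \<sigma>V \<sigma>E T = card P"
    by (auto simp: max_essential_packing_def)
  have "\<exists>Y. sep Y \<and> Y \<inter> T = {s, \<sigma>V s} \<and> int (card (cut G Y)) = l {s, \<sigma>V s}" if "s \<in> S" for s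
    using l_attained[OF sep_pair(1)[OF that]] sep_pair(2)[OF that] by simp
  then obtain X where X: "\<And>s. s \<in> S \<Longrightarrow> sep (X s) \<and> X s \<inter> T = {s, \<sigma>V s}
      \<and> int (card (cut G (X s))) = l {s, \<sigma>V s}" by metis
  have "2 * int (card P) \<le> (\<Sum>s \<in> S. int (card (cut G (X s))))"
    using X by (intro packing_le_sum_cuts[OF S P(1)]) (auto simp: separating_def)
  also have "\<dots> = (\<Sum>s \<in> S. int (min_symmetric_cut G \<sigma>V T s))"
    using X l_min by (intro sum.cong) auto
  finally show "2 * int (max_essential_packing G \<sigma>V \<sigma>E T) \<le> (\<Sum>s \<in> S. int (min_symmetric_cut G \<sigma>V T s))"
    using P by simp

  let ?A = "(\<lambda>e. [e]) ` arcs G"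
  note init = walk_system_singletons[OF T_subset T_symmetric Eulerian]
  have "l (X \<inter> T) \<le> cut_size (walk_graph G ?A) X \<and> 4 dvd cut_size (walk_graph G ?A) X - l (X \<inter> T)"
    if X: "sep X" for X
  proof -
    \<comment> \<open>The minimum is itself the size of a symmetric cut with the same terminals, so
      the congruence modulo 4 applies to it.\<close>
    obtain Y where Y: "sep Y" "Y \<inter> T = X \<inter> T" "int (card (cut G Y)) = l (X \<inter> T)"
      using l_attained[OF X] by blast
    then have "cut_size G Y = l (X \<inter> T)" using card_cut[of Y] by (simp add: separating_def)
    then show ?thesis
      using l_le[OF X] cut_size_cong_mod_4[OF X Y(1)] Y(2) init(2)[of X] by simp
  qed
  then obtain B where B: "walk_system G \<sigma>V \<sigma>E T B"
      "\<And>p. p \<in> B \<Longrightarrow> tail G (hd p) \<in> T \<and> head G (last p) \<in> T"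
      "\<And>X. sep X \<Longrightarrow> l (X \<inter> T) \<le> cut_size (walk_graph G B) X"
    using ex_terminal_walk_system[OF T_subset T_symmetric init(1)] by blast
  interpret B: inner_Eulerian_skew_graph "walk_graph G B" \<sigma>V "symmetric_path \<sigma>E" T
    using B(1) by (simp add: walk_system_def)
  obtain Q where Q: "Q \<in> essential_packings G \<sigma>V \<sigma>E T"
    "card Q = card {p \<in> B. head G (last p) \<noteq> \<sigma>V (tail G (hd p))}"
    using ex_essential_packing[OF T_subset T_symmetric B(1,2)] by blast
  \<comment> \<open>Splitting preserved the minima as lower bounds, in particular for the cuts
    around the bare pairs \<open>{s, \<sigma>V s}\<close>.\<close>
  have "(\<Sum>s \<in> S. int (min_symmetric_cut G \<sigma>V T s)) \<le> (\<Sum>s \<in> S. cut_size (walk_graph G B) {s, \<sigma>V s})"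
    using B(3)[OF sep_pair(1)] sep_pair(2) l_min by (intro sum_mono) metis
  also have "\<dots> \<le> 2 * int (card Q)"
    using B.sum_cuts_le_essential[OF S] B(2) Q(2) by simp
  also have "card Q \<le> max_essential_packing G \<sigma>V \<sigma>E T"
    unfolding max_essential_packing_def using packings Q(1) by (intro Max_ge) auto
  finally show "(\<Sum>s \<in> S. int (min_symmetric_cut G \<sigma>V T s)) \<le> 2 * int (max_essential_packing G \<sigma>V \<sigma>E T)"
    by simp
qed

end

theorem corollary3p1:
  fixes G :: "('a, 'b) pre_digraph"
    and \<sigma>V :: "'a \<Rightarrow> 'a" and \<sigma>E :: "'b \<Rightarrow> 'b"
    and S T :: "'a set"
  assumes "skew_symmetric_graph G \<sigma>V \<sigma>E"
    and "T \<subseteq> verts G" and "\<sigma>V ` T = T"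
    and "T = S \<union> \<sigma>V ` S" and "S \<inter> \<sigma>V ` S = {}"
    and "inner_Eulerian G T"
  shows "real (max_essential_packing G \<sigma>V \<sigma>E T) =
    1 / 2 * (\<Sum>s \<in> S. real (min_symmetric_cut G \<sigma>V T s))"
proof -
  interpret inner_Eulerian_skew_graph G \<sigma>V \<sigma>E T
    using assms by (simp add: inner_Eulerian_skew_graph_def inner_Eulerian_skew_graph_axioms_def)
  have "real_of_int (2 * int (max_essential_packing G \<sigma>V \<sigma>E T)) =
      real_of_int (\<Sum>s \<in> S. int (min_symmetric_cut G \<sigma>V T s))"
    using max_essential_packing_eq[OF assms(4,5)] by simp
  then show ?thesis by simp
qed

end
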